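(* Let $\mathcal{R}_{12}^r=\{\overline{\mathrm{Ref}},\mathrm{Rep}_1^{r},\mathrm{Rep}_2^{r}\}$. Then the structural rules are admissible in $\mathbf{G3[mic]}^{\mathcal{R}_{12}^r}$ (that is, in each of $\mathbf{G3m}^{\mathcal{R}_{12}^r}$, $\mathbf{G3i}^{\mathcal{R}_{12}^r}$, $\mathbf{G3c}^{\mathcal{R}_{12}^r}$).
   Context: Formulas are those of a first-order language with equality (constants and function symbols allowed), with bound variables syntactically distinct from free ones; equalities $t=t'$ are atomic; $\bot$ is not counted as atomic. A sequent $\Gamma\Rightarrow\Delta$ consists of finite multisets $\Gamma,\Delta$ of formulas; comma is multiset union. $F[x/r]$ is the result of replacing all free occurrences of $x$ in $F$ by the term $r$. Logical calculi. $\mathbf{G3c}$ has initial sequents $P,\Gamma\Rightarrow\Delta,P$ ($P$ atomic) and the rules: $L\wedge$: from $A,B,\Gamma\Rightarrow\Delta$ infer $A\wedge B,\Gamma\Rightarrow\Delta$. $R\wedge$: from $\Gamma\Rightarrow\Delta,A$ and $\Gamma\Rightarrow\Delta,B$ infer $\Gamma\Rightarrow\Delta,A\wedge B$. $L\vee$: from $A,\Gamma\Rightarrow\Delta$ and $B,\Gamma\Rightarrow\Delta$ infer $A\vee B,\Gamma\Rightarrow\Delta$. $R\vee$: from $\Gamma\Rightarrow\Delta,A,B$ infer $\Gamma\Rightarrow\Delta,A\vee B$. $L\to$: from $\Gamma\Rightarrow\Delta,A$ and $B,\Gamma\Rightarrow\Delta$ infer $A\to B,\Gamma\Rightarrow\Delta$.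 $R\to$: from $A,\Gamma\Rightarrow\Delta,B$ infer $\Gamma\Rightarrow\Delta,A\to B$. $L\bot$: infer $\bot,\Gamma\Rightarrow\Delta$ (no premiss). $L\forall$: from $A[x/t],\forall xA,\Gamma\Rightarrow\Delta$ infer $\forall xA,\Gamma\Rightarrow\Delta$. $R\forall$: from $\Gamma\Rightarrow\Delta,A[x/a]$ infer $\Gamma\Rightarrow\Delta,\forall xA$. $L\exists$: from $A[x/a],\Gamma\Rightarrow\Delta$ infer $\exists xA,\Gamma\Rightarrow\Delta$. $R\exists$: from $\Gamma\Rightarrow\Delta,\exists xA,A[x/t]$ infer $\Gamma\Rightarrow\Delta,\exists xA$. In $L\exists$ and the $R\forall$ rules, $a$ is a free variable not occurring in the conclusion. $\mathbf{G3i}$ is $\mathbf{G3c}$ with $L\to,R\to,R\forall$ replaced by: $L^i\to$: from $A\to B,\Gamma\Rightarrow\Delta,A$ and $B,\Gamma\Rightarrow\Delta$ infer $A\to B,\Gamma\Rightarrow\Delta$; $R^i\to$: from $A,\Gamma\Rightarrow B$ infer $\Gamma\Rightarrow\Delta,A\to B$; $R^i\forall$: from $\Gamma\Rightarrow A[x/a]$ infer $\Gamma\Rightarrow\Delta,\forall xA$. $\mathbf{G3m}$ is $\mathbf{G3i}$ with $L\bot$ replaced by the initial sequents $\bot,\Gamma\Rightarrow\Delta,\bot$. $\mathbf{G3[mic]}$ denotes any of the three; $\mathbf{G3[mic]}^{\mathcal R}$ is it together with the rules in $\mathcal R$. Structural rules: weakening (from $\Gamma\Rightarrow\Delta$ infer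 $A,\Gamma\Rightarrow\Delta$; from $\Gamma\Rightarrow\Delta$ infer $\Gamma\Rightarrow\Delta,A$), contraction (from $A,A,\Gamma\Rightarrow\Delta$ infer $A,\Gamma\Rightarrow\Delta$; from $\Gamma\Rightarrow\Delta,A,A$ infer $\Gamma\Rightarrow\Delta,A$), and Cut (from $\Gamma\Rightarrow\Delta,A$ and $A,\Lambda\Rightarrow\Theta$ infer $\Gamma,\Lambda\Rightarrow\Delta,\Theta$), for arbitrary formulas $A$. A rule is admissible in a calculus if its conclusion is derivable whenever its premisses are. Equality rules ($P$ atomic, possibly an equality). $\overline{\mathrm{Ref}}$: axioms $\Gamma\Rightarrow\Delta,t=t$. $\mathrm{Rep}_1^{r}$: from $r=s,\Gamma\Rightarrow\Delta,P[x/r]$ infer $r=s,\Gamma\Rightarrow\Delta,P[x/s]$. $\mathrm{Rep}_2^{r}$: from $s=r,\Gamma\Rightarrow\Delta,P[x/r]$ infer $s=r,\Gamma\Rightarrow\Delta,P[x/s]$. *)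

theory Defs
  imports "HOL-Library.Multiset"
begin

text \<open>
  Free variables and bound variables form two disjoint sorts, each a copy of the natural numbers.
  The datatypes contain raw expressions, in which a bound variable may occur outside the scope of
  a quantifier; terms and formulas proper are singled out by \<open>is_term\<close> and \<open>is_formula\<close> below.
\<close>

datatype 'f tm = FVar nat | BVar nat | Fn 'f "'f tm list"

datatype ('f, 'p) fm =
    Pred 'p "'f tm list"
  | Eq "'f tm" "'f tm"
  | Bot
  | Conj "('f, 'p) fm" "('f, 'p) fm"
  | Disj "('f, 'p) fm" "('f, 'p) fm"
  | Imp "('f, 'p) fm" "('f, 'p) fm"
  | Forall nat "('f, 'p) fm"
  | Exists nat "('f, 'p) fm"

text \<open>
  Arities are partial, so that a language may lack function symbols or predicate symbols
  altogether. Constants are function symbols of arity 0.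
\<close>

record ('f, 'p) language =
  fun_arity :: "'f \<Rightarrow> nat option"
  pred_arity :: "'p \<Rightarrow> nat option"

text \<open>The set \<open>X\<close> contains the bound variables that are allowed to occur unbound.\<close>

fun wf_tm :: "('f, 'p) language \<Rightarrow> nat set \<Rightarrow> 'f tm \<Rightarrow> bool" where
  "wf_tm L X (FVar a) \<longleftrightarrow> True"
| "wf_tm L X (BVar x) \<longleftrightarrow> x \<in> X"
| "wf_tm L X (Fn f ts) \<longleftrightarrow> fun_arity L f = Some (length ts) \<and> (\<forall>t\<in>set ts. wf_tm L X t)"

fun wf_fm :: "('f, 'p) language \<Rightarrow> nat set \<Rightarrow> ('f, 'p) fm \<Rightarrow> bool" where
  "wf_fm L X (Pred p ts) \<longleftrightarrow> pred_arity L p = Some (length ts) \<and> (\<forall>t\<in>set ts. wf_tm L X t)"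
| "wf_fm L X (Eq t u) \<longleftrightarrow> wf_tm L X t \<and> wf_tm L X u"
| "wf_fm L X Bot \<longleftrightarrow> True"
| "wf_fm L X (Conj A B) \<longleftrightarrow> wf_fm L X A \<and> wf_fm L X B"
| "wf_fm L X (Disj A B) \<longleftrightarrow> wf_fm L X A \<and> wf_fm L X B"
| "wf_fm L X (Imp A B) \<longleftrightarrow> wf_fm L X A \<and> wf_fm L X B"
| "wf_fm L X (Forall x A) \<longleftrightarrow> wf_fm L (insert x X) A"
| "wf_fm L X (Exists x A) \<longleftrightarrow> wf_fm L (insert x X) A"

definition is_term :: "('f, 'p) language \<Rightarrow> 'f tm \<Rightarrow> bool" where
  "is_term L t \<longleftrightarrow> wf_tm L {} t"

definition is_formula :: "('f, 'p) language \<Rightarrow> ('f, 'p) fm \<Rightarrow> bool" where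
  "is_formula L A \<longleftrightarrow> wf_fm L {} A"

fun is_atomic :: "('f, 'p) fm \<Rightarrow> bool" where
  "is_atomic (Pred p ts) \<longleftrightarrow> True"
| "is_atomic (Eq t u) \<longleftrightarrow> True"
| "is_atomic _ \<longleftrightarrow> False"

fun fv_tm :: "'f tm \<Rightarrow> nat set" where
  "fv_tm (FVar a) = {a}"
| "fv_tm (BVar x) = {}"
| "fv_tm (Fn f ts) = (\<Union>t\<in>set ts. fv_tm t)"

fun fv :: "('f, 'p) fm \<Rightarrow> nat set" where
  "fv (Pred p ts) = (\<Union>t\<in>set ts. fv_tm t)"
| "fv (Eq t u) = fv_tm t \<union> fv_tm u"
| "fv Bot = {}"
| "fv (Conj A B) = fv A \<union> fv B"
| "fv (Disj A B) = fv A \<union> fv B"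
| "fv (Imp A B) = fv A \<union> fv B"
| "fv (Forall x A) = fv A"
| "fv (Exists x A) = fv A"

fun subst_tm :: "'f tm \<Rightarrow> nat \<Rightarrow> 'f tm \<Rightarrow> 'f tm" where
  "subst_tm (FVar a) x r = FVar a"
| "subst_tm (BVar y) x r = (if y = x then r else BVar y)"
| "subst_tm (Fn f ts) x r = Fn f (map (\<lambda>t. subst_tm t x r) ts)"

text \<open>
  \<open>subst A x r\<close> is A[x/r]. It is only used with terms \<open>r\<close> in the sense of \<open>is_term\<close>; these
  contain no bound variables, so that no capture can occur.
\<close>

fun subst :: "('f, 'p) fm \<Rightarrow> nat \<Rightarrow> 'f tm \<Rightarrow> ('f, 'p) fm" where
  "subst (Pred p ts) x r = Pred p (map (\<lambda>t. subst_tm t x r) ts)"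
| "subst (Eq t u) x r = Eq (subst_tm t x r) (subst_tm u x r)"
| "subst Bot x r = Bot"
| "subst (Conj A B) x r = Conj (subst A x r) (subst B x r)"
| "subst (Disj A B) x r = Disj (subst A x r) (subst B x r)"
| "subst (Imp A B) x r = Imp (subst A x r) (subst B x r)"
| "subst (Forall y A) x r = Forall y (if y = x then A else subst A x r)"
| "subst (Exists y A) x r = Exists y (if y = x then A else subst A x r)"

datatype ('f, 'p) sequent =
  Sequent (antecedent: "('f, 'p) fm multiset") (succedent: "('f, 'p) fm multiset")
    (infix "\<turnstile>" 50)

definition is_sequent :: "('f, 'p) language \<Rightarrow> ('f, 'p) sequent \<Rightarrow> bool" where
  "is_sequent L S \<longleftrightarrow> (\<forall>A \<in># antecedent S + succedent S. is_formula L A)"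

definition fv_sequent :: "('f, 'p) sequent \<Rightarrow> nat set" where
  "fv_sequent S = (\<Union>A \<in> set_mset (antecedent S + succedent S). fv A)"

text \<open>A rule is the set of its instances, each a list of premisses with a conclusion.\<close>

type_synonym ('f, 'p) rule = "(('f, 'p) sequent list \<times> ('f, 'p) sequent) set"

text \<open>
  The rules are formulated for raw expressions. Derivations consist of sequents of the
  language \<open>L\<close> only: every conclusion is required to be one, hence so is every premiss.
\<close>

inductive derivable ::
  "('f, 'p) language \<Rightarrow> ('f, 'p) rule set \<Rightarrow> ('f, 'p) sequent \<Rightarrow> bool"
  for L :: "('f, 'p) language" and C :: "('f, 'p) rule set" where
  step: "\<lbrakk>\<rho> \<in> C; (Ss, S) \<in> \<rho>; \<forall>S' \<in> set Ss. derivable L C S'; is_sequent L S\<rbrakk>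
    \<Longrightarrow> derivable L C S"

definition admissible ::
  "('f, 'p) language \<Rightarrow> ('f, 'p) rule set \<Rightarrow> ('f, 'p) rule \<Rightarrow> bool" where
  "admissible L C \<rho> \<longleftrightarrow>
    (\<forall>(Ss, S) \<in> \<rho>. is_sequent L S \<longrightarrow> (\<forall>S' \<in> set Ss. derivable L C S') \<longrightarrow> derivable L C S)"


subsection \<open>Logical rules\<close>

definition Init :: "('f, 'p) rule" where
  "Init = {([], {#P#} + \<Gamma> \<turnstile> \<Delta> + {#P#}) | P \<Gamma> \<Delta>. is_atomic P}"

definition L_and :: "('f, 'p) rule" where
  "L_and = {([{#A, B#} + \<Gamma> \<turnstile> \<Delta>], {#Conj A B#} + \<Gamma> \<turnstile> \<Delta>) | A B \<Gamma> \<Delta>. True}"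

definition R_and :: "('f, 'p) rule" where
  "R_and = {([\<Gamma> \<turnstile> \<Delta> + {#A#}, \<Gamma> \<turnstile> \<Delta> + {#B#}], \<Gamma> \<turnstile> \<Delta> + {#Conj A B#}) | A B \<Gamma> \<Delta>. True}"

definition L_or :: "('f, 'p) rule" where
  "L_or = {([{#A#} + \<Gamma> \<turnstile> \<Delta>, {#B#} + \<Gamma> \<turnstile> \<Delta>], {#Disj A B#} + \<Gamma> \<turnstile> \<Delta>) | A B \<Gamma> \<Delta>. True}"

definition R_or :: "('f, 'p) rule" where
  "R_or = {([\<Gamma> \<turnstile> \<Delta> + {#A, B#}], \<Gamma> \<turnstile> \<Delta> + {#Disj A B#}) | A B \<Gamma> \<Delta>. True}"

definition L_imp :: "('f, 'p) rule" where
  "L_imp = {([\<Gamma> \<turnstile> \<Delta> + {#A#}, {#B#} + \<Gamma> \<turnstile> \<Delta>], {#Imp A B#} + \<Gamma> \<turnstile> \<Delta>) | A B \<Gamma> \<Delta>. True}"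

definition R_imp :: "('f, 'p) rule" where
  "R_imp = {([{#A#} + \<Gamma> \<turnstile> \<Delta> + {#B#}], \<Gamma> \<turnstile> \<Delta> + {#Imp A B#}) | A B \<Gamma> \<Delta>. True}"

definition L_bot :: "('f, 'p) rule" where
  "L_bot = {([], {#Bot#} + \<Gamma> \<turnstile> \<Delta>) | \<Gamma> \<Delta>. True}"

definition L_all :: "('f, 'p) language \<Rightarrow> ('f, 'p) rule" where
  "L_all L = {([{#subst A x t, Forall x A#} + \<Gamma> \<turnstile> \<Delta>], {#Forall x A#} + \<Gamma> \<turnstile> \<Delta>)
    | A x t \<Gamma> \<Delta>. is_term L t}"

definition R_all :: "('f, 'p) rule" where
  "R_all = {([\<Gamma> \<turnstile> \<Delta> + {#subst A x (FVar a)#}], \<Gamma> \<turnstile> \<Delta> + {#Forall x A#})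
    | A x a \<Gamma> \<Delta>. a \<notin> fv_sequent (\<Gamma> \<turnstile> \<Delta> + {#Forall x A#})}"

definition L_ex :: "('f, 'p) rule" where
  "L_ex = {([{#subst A x (FVar a)#} + \<Gamma> \<turnstile> \<Delta>], {#Exists x A#} + \<Gamma> \<turnstile> \<Delta>)
    | A x a \<Gamma> \<Delta>. a \<notin> fv_sequent ({#Exists x A#} + \<Gamma> \<turnstile> \<Delta>)}"

definition R_ex :: "('f, 'p) language \<Rightarrow> ('f, 'p) rule" where
  "R_ex L = {([\<Gamma> \<turnstile> \<Delta> + {#Exists x A, subst A x t#}], \<Gamma> \<turnstile> \<Delta> + {#Exists x A#})
    | A x t \<Gamma> \<Delta>. is_term L t}"

definition Li_imp :: "('f, 'p) rule" where
  "Li_imp = {([{#Imp A B#} + \<Gamma> \<turnstile> \<Delta> + {#A#}, {#B#} + \<Gamma> \<turnstile> \<Delta>], {#Imp A B#} + \<Gamma> \<turnstile> \<Delta>)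
    | A B \<Gamma> \<Delta>. True}"

definition Ri_imp :: "('f, 'p) rule" where
  "Ri_imp = {([{#A#} + \<Gamma> \<turnstile> {#B#}], \<Gamma> \<turnstile> \<Delta> + {#Imp A B#}) | A B \<Gamma> \<Delta>. True}"

definition Ri_all :: "('f, 'p) rule" where
  "Ri_all = {([\<Gamma> \<turnstile> {#subst A x (FVar a)#}], \<Gamma> \<turnstile> \<Delta> + {#Forall x A#})
    | A x a \<Gamma> \<Delta>. a \<notin> fv_sequent (\<Gamma> \<turnstile> \<Delta> + {#Forall x A#})}"

definition Init_bot :: "('f, 'p) rule" where
  "Init_bot = {([], {#Bot#} + \<Gamma> \<turnstile> \<Delta> + {#Bot#}) | \<Gamma> \<Delta>. True}"

definition G3c :: "('f, 'p) language \<Rightarrow> ('f, 'p) rule set" where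
  "G3c L = {Init, L_and, R_and, L_or, R_or, L_imp, R_imp, L_bot, L_all L, R_all, L_ex, R_ex L}"

definition G3i :: "('f, 'p) language \<Rightarrow> ('f, 'p) rule set" where
  "G3i L = {Init, L_and, R_and, L_or, R_or, Li_imp, Ri_imp, L_bot, L_all L, Ri_all, L_ex, R_ex L}"

definition G3m :: "('f, 'p) language \<Rightarrow> ('f, 'p) rule set" where
  "G3m L = {Init, L_and, R_and, L_or, R_or, Li_imp, Ri_imp, Init_bot, L_all L, Ri_all, L_ex, R_ex L}"


subsection \<open>Equality rules\<close>

definition Ref :: "('f, 'p) rule" where
  "Ref = {([], \<Gamma> \<turnstile> \<Delta> + {#Eq t t#}) | t \<Gamma> \<Delta>. True}"

text \<open>
  In the replacement rules \<open>x\<close> is a bound variable, as in the quantifier rules, which marks the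
  occurrences to be replaced; \<open>P\<close> is hence a raw atom, while \<open>subst P x r\<close> and \<open>subst P x s\<close> are
  formulas. Letting \<open>x\<close> be a free variable would give the same instances, because formulas that
  are atomic contain no bound variables.
\<close>

definition Rep1_r :: "('f, 'p) rule" where
  "Rep1_r = {([{#Eq r s#} + \<Gamma> \<turnstile> \<Delta> + {#subst P x r#}], {#Eq r s#} + \<Gamma> \<turnstile> \<Delta> + {#subst P x s#})
    | P x r s \<Gamma> \<Delta>. is_atomic P}"

definition Rep2_r :: "('f, 'p) rule" where
  "Rep2_r = {([{#Eq s r#} + \<Gamma> \<turnstile> \<Delta> + {#subst P x r#}], {#Eq s r#} + \<Gamma> \<turnstile> \<Delta> + {#subst P x s#})
    | P x r s \<Gamma> \<Delta>. is_atomic P}"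

definition R12_r :: "('f, 'p) rule set" where
  "R12_r = {Ref, Rep1_r, Rep2_r}"


subsection \<open>Structural rules\<close>

definition L_weakening :: "('f, 'p) rule" where
  "L_weakening = {([\<Gamma> \<turnstile> \<Delta>], {#A#} + \<Gamma> \<turnstile> \<Delta>) | A \<Gamma> \<Delta>. True}"

definition R_weakening :: "('f, 'p) rule" where
  "R_weakening = {([\<Gamma> \<turnstile> \<Delta>], \<Gamma> \<turnstile> \<Delta> + {#A#}) | A \<Gamma> \<Delta>. True}"

definition L_contraction :: "('f, 'p) rule" where
  "L_contraction = {([{#A, A#} + \<Gamma> \<turnstile> \<Delta>], {#A#} + \<Gamma> \<turnstile> \<Delta>) | A \<Gamma> \<Delta>. True}"

definition R_contraction :: "('f, 'p) rule" where
  "R_contraction = {([\<Gamma> \<turnstile> \<Delta> + {#A, A#}], \<Gamma> \<turnstile> \<Delta> + {#A#}) | A \<Gamma> \<Delta>. True}"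

definition Cut :: "('f, 'p) rule" where
  "Cut = {([\<Gamma> \<turnstile> \<Delta> + {#A#}, {#A#} + \<Lambda> \<turnstile> \<Theta>], \<Gamma> + \<Lambda> \<turnstile> \<Delta> + \<Theta>) | A \<Gamma> \<Delta> \<Lambda> \<Theta>. True}"

definition structural_rules :: "('f, 'p) rule set" where
  "structural_rules = {L_weakening, R_weakening, L_contraction, R_contraction, Cut}"

end

theory Submission
  imports Defs
begin

text \<open>
  The replacement rules rewrite an atom of the succedent by an equation of the antecedent. Atoms
  are never principal in a logical rule, and the logical rules pass the atoms of the antecedent on
  to all premisses. So nothing is lost if equational reasoning takes place at the leaves only:
  the calculus has the same strength as the purely logical one whose initial sequents are all
  \<open>\<Gamma> \<turnstile> \<Delta> + {#A#}\<close> such that the atoms of \<open>\<Gamma>\<close> entail \<open>A\<close> in the logic of equality (\<open>entails\<close>).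
  Such initial sequents are preserved by weakening and contraction. They are also preserved by
  cuts on atoms, because this entailment is transitive (\<open>entails_cut\<close>). Equations thus pose no
  problem beyond the known proofs for the logical calculi.

  The calculus \<open>der\<close> with these initial sequents is set up so that those proofs are short. A
  sequent is one multiset of signed formulas, so that antecedent and succedent are treated alike,
  and all logical rules are instances of a single scheme: a principal formula \<open>\<phi>\<close> and a set of
  multisets, one per premiss, that replace it. Two Boolean parameters select one of the three
  logics. The rules with an eigenvariable get a premiss for every term instead. Hence no
  variable has to be renamed when a context is changed, and all structural proofs are inductions
  over derivations, without a notion of height.

  Contraction goes by induction on the rank of the formula: a repeated principal formula is
  inverted (\<open>inversion\<close>), and what results is contracted by the induction hypothesis. From
  weakening and contraction together, derivability depends only on the sets underlying the
  multisets (\<open>der_mono\<close>), and cut may be proved for shared contexts (\<open>cut\<close>).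

  It remains to compare \<open>der\<close> with the given calculi (\<open>derivable_iff_der\<close>). In one direction, an
  entailed atom is derived by replacement from an initial sequent (\<open>derivable_entailed\<close>), and among
  the premisses of a quantifier rule the one with a fresh variable is chosen. In the other
  direction, an eigenvariable is replaced by an arbitrary term (\<open>der_eigenvariable\<close>), and the
  replacement rules are cuts with an initial sequent (\<open>der_sign_replace\<close>).
\<close>

section \<open>Terms and substitution\<close>

fun fsubst_tm :: "(nat \<Rightarrow> 'f tm) \<Rightarrow> 'f tm \<Rightarrow> 'f tm" where
  "fsubst_tm \<sigma> (FVar a) = \<sigma> a"
| "fsubst_tm \<sigma> (BVar x) = BVar x"
| "fsubst_tm \<sigma> (Fn f ts) = Fn f (map (fsubst_tm \<sigma>) ts)"

fun fsubst :: "(nat \<Rightarrow> 'f tm) \<Rightarrow> ('f, 'p) fm \<Rightarrow> ('f, 'p) fm" where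
  "fsubst \<sigma> (Pred p ts) = Pred p (map (fsubst_tm \<sigma>) ts)"
| "fsubst \<sigma> (Eq t u) = Eq (fsubst_tm \<sigma> t) (fsubst_tm \<sigma> u)"
| "fsubst \<sigma> Bot = Bot"
| "fsubst \<sigma> (Conj A B) = Conj (fsubst \<sigma> A) (fsubst \<sigma> B)"
| "fsubst \<sigma> (Disj A B) = Disj (fsubst \<sigma> A) (fsubst \<sigma> B)"
| "fsubst \<sigma> (Imp A B) = Imp (fsubst \<sigma> A) (fsubst \<sigma> B)"
| "fsubst \<sigma> (Forall x A) = Forall x (fsubst \<sigma> A)"
| "fsubst \<sigma> (Exists x A) = Exists x (fsubst \<sigma> A)"

text \<open>
  Unlike the size of the datatype, the rank ignores terms, so that an instance of a quantified
  formula has a smaller rank than the formula itself.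
\<close>

fun rank :: "('f, 'p) fm \<Rightarrow> nat" where
  "rank (Conj A B) = Suc (rank A + rank B)"
| "rank (Disj A B) = Suc (rank A + rank B)"
| "rank (Imp A B) = Suc (rank A + rank B)"
| "rank (Forall x A) = Suc (rank A)"
| "rank (Exists x A) = Suc (rank A)"
| "rank _ = 0"

lemma rank_subst [simp]: "rank (subst A x t) = rank A"
  by (induction A) auto

lemma subst_neq_quantified [simp]:
  "subst A x t \<noteq> Forall y A" "Forall y A \<noteq> subst A x t"
  "subst A x t \<noteq> Exists y A" "Exists y A \<noteq> subst A x t"
  by (metis n_not_Suc_n rank.simps(4,5) rank_subst)+

lemma finite_fv_tm [simp]: "finite (fv_tm t)"
  by (induction t) auto

lemma finite_fv [simp]: "finite (fv A)"
  by (induction A) auto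

lemma is_term_FVar [simp]: "is_term L (FVar a)"
  by (simp add: is_term_def)

lemma subst_tm_closed: "is_term L t \<Longrightarrow> subst_tm t x r = t"
  unfolding is_term_def by (induction t) (auto intro: map_idI)

lemma subst_tm_subst_tm: "subst_tm (subst_tm p x q) x t = subst_tm p x (subst_tm q x t)"
  by (induction p) auto

lemma subst_subst: "is_atomic P \<Longrightarrow> subst (subst P x (q :: 'f tm)) x t = subst P x (subst_tm q x t)"
  by (cases P) (auto simp: subst_tm_subst_tm)

lemma wf_tm_mono: "wf_tm L X t \<Longrightarrow> X \<subseteq> Y \<Longrightarrow> wf_tm L Y t"
  by (induction t) auto

lemma wf_tm_subst_tm:
  "wf_tm L (insert x X) t \<Longrightarrow> is_term L r \<Longrightarrow> wf_tm L X (subst_tm t x r)"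
  unfolding is_term_def by (induction t) (auto intro: wf_tm_mono)

lemma wf_fm_subst:
  "wf_fm L (insert x X) A \<Longrightarrow> is_term L t \<Longrightarrow> wf_fm L X (subst A x t)"
proof (induction A arbitrary: X)
  case (Forall y A)
  then show ?case by (cases "y = x") (auto simp: insert_commute)
next
  case (Exists y A)
  then show ?case by (cases "y = x") (auto simp: insert_commute)
qed (auto intro: wf_tm_subst_tm)

lemma is_formula_subst_Forall:
  "is_formula L (Forall x A) \<Longrightarrow> is_term L t \<Longrightarrow> is_formula L (subst A x t)"
  by (simp add: is_formula_def wf_fm_subst)

lemma is_formula_subst_Exists:
  "is_formula L (Exists x A) \<Longrightarrow> is_term L t \<Longrightarrow> is_formula L (subst A x t)"
  by (simp add: is_formula_def wf_fm_subst)

lemma is_formula_simps [simp]: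
  "is_formula L (Eq t u) \<longleftrightarrow> is_term L t \<and> is_term L u"
  "is_formula L (Conj A B) \<longleftrightarrow> is_formula L A \<and> is_formula L B"
  "is_formula L (Disj A B) \<longleftrightarrow> is_formula L A \<and> is_formula L B"
  "is_formula L (Imp A B) \<longleftrightarrow> is_formula L A \<and> is_formula L B"
  by (auto simp: is_formula_def is_term_def)

lemma wf_tm_replace:
  "wf_tm L X (subst_tm t x r) \<Longrightarrow> is_term L s \<Longrightarrow> wf_tm L X (subst_tm t x s)"
  unfolding is_term_def by (induction t) (auto intro: wf_tm_mono)

lemma is_formula_replace:
  "is_atomic P \<Longrightarrow> is_formula L (subst P x r) \<Longrightarrow> is_term L s \<Longrightarrow> is_formula L (subst P x s)"
  by (cases P) (auto simp: is_formula_def is_term_def intro: wf_tm_replace[unfolded is_term_def])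

lemma fsubst_tm_subst_tm:
  assumes "\<And>a. is_term L (\<sigma> a)"
  shows "fsubst_tm \<sigma> (subst_tm t x r) = subst_tm (fsubst_tm \<sigma> t) x (fsubst_tm \<sigma> r)"
  by (induction t) (auto simp: subst_tm_closed[OF assms])

lemma fsubst_subst:
  assumes "\<And>a. is_term L (\<sigma> a)"
  shows "fsubst \<sigma> (subst A x r) = subst (fsubst \<sigma> A) x (fsubst_tm \<sigma> r)"
  by (induction A) (auto simp: fsubst_tm_subst_tm[OF assms])

lemma fsubst_tm_cong: "(\<And>a. a \<in> fv_tm t \<Longrightarrow> \<sigma> a = \<tau> a) \<Longrightarrow> fsubst_tm \<sigma> t = fsubst_tm \<tau> t"
  by (induction t) auto

lemma fsubst_cong: "(\<And>a. a \<in> fv A \<Longrightarrow> \<sigma> a = \<tau> a) \<Longrightarrow> fsubst \<sigma> A = fsubst \<tau> A"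
  by (induction A) (auto intro: fsubst_tm_cong)

lemma fsubst_tm_FVar [simp]: "fsubst_tm FVar t = t"
  by (induction t) (auto intro: map_idI)

lemma fsubst_FVar [simp]: "fsubst FVar A = A"
  by (induction A) (auto intro: map_idI)

lemma is_term_fsubst_tm:
  assumes "\<And>a. is_term L (\<sigma> a)"
  shows "is_term L t \<Longrightarrow> is_term L (fsubst_tm \<sigma> t)"
  using assms unfolding is_term_def by (induction t) auto

text \<open>
  A fresh variable is a generic instance: all instances of \<open>A\<close> arise from it by substitution.
\<close>

lemma fsubst_fresh_subst:
  assumes "\<And>a. is_term L (\<sigma> a)" and "is_term L t" and "a \<notin> fv A"
  shows "fsubst (\<sigma>(a := t)) (subst A x (FVar a)) = subst (fsubst \<sigma> A) x t"
proof -
  have "fsubst (\<sigma>(a := t)) (subst A x (FVar a)) = subst (fsubst (\<sigma>(a := t)) A) x t"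
    using assms by (subst fsubst_subst[where L = L]) auto
  also have "fsubst (\<sigma>(a := t)) A = fsubst \<sigma> A"
    using assms(3) by (intro fsubst_cong) auto
  finally show ?thesis .
qed


section \<open>Entailment between atoms\<close>

text \<open>
  The congruence generated by the equations in \<open>G\<close>. Only one argument changes at a time, as in a
  single application of a replacement rule.
\<close>

inductive eqv :: "('f, 'p) fm set \<Rightarrow> 'f tm \<Rightarrow> 'f tm \<Rightarrow> bool" for G where
  base: "Eq t u \<in> G \<Longrightarrow> eqv G t u"
| refl: "eqv G t t"
| sym: "eqv G t u \<Longrightarrow> eqv G u t"
| trans: "eqv G t u \<Longrightarrow> eqv G u v \<Longrightarrow> eqv G t v"
| arg: "eqv G t u \<Longrightarrow> eqv G (Fn f (ts @ t # us)) (Fn f (ts @ u # us))"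

text \<open>
  The reflexive equations that the first clause contains account for the rule \<open>Ref\<close>. Falsum is
  included for the sake of the initial sequents of minimal logic; it then shares all arguments
  with the atoms.
\<close>

inductive entails :: "('f, 'p) fm set \<Rightarrow> ('f, 'p) fm \<Rightarrow> bool" for G where
  Eq: "eqv G t u \<Longrightarrow> entails G (Eq t u)"
| Pred: "Pred p ts \<in> G \<Longrightarrow> list_all2 (eqv G) ts us \<Longrightarrow> entails G (Pred p us)"
| Bot: "Bot \<in> G \<Longrightarrow> entails G Bot"

inductive_cases entails_EqE: "entails G (Eq t u)"
inductive_cases entails_PredE: "entails G (Pred p us)"
inductive_cases entails_BotE: "entails G Bot"

lemma entails_atomic: "entails G A \<Longrightarrow> is_atomic A \<or> A = Bot \<and> Bot \<in> G"
  by (auto elim: entails.cases)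

lemma eqv_mono: "eqv G t u \<Longrightarrow> G \<subseteq> H \<Longrightarrow> eqv H t u"
  by (induction rule: eqv.induct) (auto intro: eqv.intros)

lemma entails_mono: "entails G A \<Longrightarrow> G \<subseteq> H \<Longrightarrow> entails H A"
proof (induction rule: entails.induct)
  case (Pred p ts us)
  have "list_all2 (eqv H) ts us"
    using Pred(2) by (rule list_all2_mono) (rule eqv_mono[OF _ Pred(3)])
  with Pred show ?case by (auto intro: entails.Pred)
qed (auto intro: entails.intros eqv_mono)

lemma eqv_args:
  "list_all2 (eqv G) ts us \<Longrightarrow> eqv G (Fn f (vs @ ts)) (Fn f (vs @ us))"
proof (induction arbitrary: vs rule: list_all2_induct)
  case Nil
  show ?case by (rule eqv.refl)
next
  case (Cons t ts u us)
  have "eqv G (Fn f (vs @ t # ts)) (Fn f (vs @ u # ts))"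
    using Cons(1) by (rule eqv.arg)
  moreover have "eqv G (Fn f (vs @ u # ts)) (Fn f (vs @ u # us))"
    using Cons(3)[of "vs @ [u]"] by simp
  ultimately show ?case by (rule eqv.trans)
qed

lemma eqv_subst_tm:
  assumes "eqv G r s"
  shows "eqv G (subst_tm t x r) (subst_tm t x s)"
proof (induction t)
  case (Fn f ts)
  then have "list_all2 (eqv G) (map (\<lambda>t. subst_tm t x r) ts) (map (\<lambda>t. subst_tm t x s) ts)"
    by (auto simp: list_all2_conv_all_nth)
  from eqv_args[OF this, of f "[]"] show ?case by simp
qed (use assms in \<open>auto intro: eqv.refl\<close>)

lemma list_all2_eqv_trans:
  "list_all2 (eqv G) ts us \<Longrightarrow> list_all2 (eqv G) us vs \<Longrightarrow> list_all2 (eqv G) ts vs"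
  by (auto simp: list_all2_conv_all_nth) (blast intro: eqv.trans)

lemma entails_member: "is_atomic A \<Longrightarrow> A \<in> G \<Longrightarrow> entails G A"
  by (cases A) (auto intro: entails.intros eqv.base eqv.refl list_all2_refl)

text \<open>
  For an equation both sides have to be rewritten; it is an equation of \<open>G\<close> and composed with
  the two rewriting steps.
\<close>

lemma entails_replace:
  assumes "is_atomic P" and "eqv G r s" and "subst P x r \<in> G"
  shows "entails G (subst P x s)"
proof (cases P)
  case (Pred p ts)
  have "list_all2 (eqv G) (map (\<lambda>t. subst_tm t x r) ts) (map (\<lambda>t. subst_tm t x s) ts)"
    using assms(2) by (auto simp: list_all2_conv_all_nth intro: eqv_subst_tm)
  with assms(3) Pred show ?thesis by (auto intro: entails.Pred)
next
  case (Eq t u)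
  with assms(3) have "eqv G (subst_tm t x r) (subst_tm u x r)" by (auto intro: eqv.base)
  then have "eqv G (subst_tm t x s) (subst_tm u x s)"
    using eqv_subst_tm[OF assms(2)] by (metis eqv.sym eqv.trans)
  with Eq show ?thesis by (auto intro: entails.Eq)
qed (use assms(1) in auto)

text \<open>
  If \<open>A\<close> is an equation, then to be entailed means that its two sides are already congruent.
\<close>

lemma eqv_cut:
  "eqv (insert A G) t u \<Longrightarrow> entails G A \<Longrightarrow> eqv G t u"
proof (induction rule: eqv.induct)
  case (base t u)
  then show ?case by (auto intro: eqv.base elim: entails_EqE)
qed (auto intro: eqv.intros)

lemma entails_cut:
  assumes "entails G A" and "entails (insert A G) B"
  shows "entails G B"
  using assms(2)
proof cases
  case (Eq t u)
  then show ?thesis using assms(1) by (auto intro: entails.Eq eqv_cut)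
next
  case (Pred p ts us)
  have eq: "list_all2 (eqv G) ts us"
    using Pred(3) by (rule list_all2_mono) (rule eqv_cut[OF _ assms(1)])
  show ?thesis
  proof (cases "Pred p ts \<in> G")
    case True
    with eq Pred(1) show ?thesis by (auto intro: entails.Pred)
  next
    case False
    with Pred(2) assms(1) have "entails G (Pred p ts)" by auto
    then show ?thesis
      using eq Pred(1) by (auto elim!: entails_PredE intro: entails.Pred list_all2_eqv_trans)
  qed
next
  case Bot
  then show ?thesis using assms(1) by (auto intro: entails.Bot elim: entails_BotE)
qed

lemma eqv_fsubst:
  "eqv G t u \<Longrightarrow> eqv (fsubst \<sigma> ` G) (fsubst_tm \<sigma> t) (fsubst_tm \<sigma> u)"
proof (induction rule: eqv.induct)
  case (base t u)
  then have "fsubst \<sigma> (Eq t u) \<in> fsubst \<sigma> ` G" by (rule imageI)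
  then show ?case by (auto intro: eqv.base)
qed (auto intro: eqv.intros)

lemma entails_fsubst:
  "entails G A \<Longrightarrow> entails (fsubst \<sigma> ` G) (fsubst \<sigma> A)"
proof (induction rule: entails.induct)
  case (Pred p ts us)
  have "fsubst \<sigma> (Pred p ts) \<in> fsubst \<sigma> ` G" using Pred(1) by (rule imageI)
  moreover have "list_all2 (eqv (fsubst \<sigma> ` G)) (map (fsubst_tm \<sigma>) ts) (map (fsubst_tm \<sigma>) us)"
    using Pred(2) by (auto simp: list_all2_conv_all_nth intro: eqv_fsubst)
  ultimately show ?case by (auto intro: entails.Pred)
next
  case Bot
  then have "fsubst \<sigma> Bot \<in> fsubst \<sigma> ` G" by (rule imageI)
  then show ?case by (auto intro: entails.Bot)
qed (auto intro: entails.Eq eqv_fsubst)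

text \<open>
  A chain of equations between terms of the language cannot leave the language, since its links
  are themselves formulas of the language. So every step of such a chain is a legal inference.
\<close>

lemma eqv_is_term:
  "eqv G t u \<Longrightarrow> \<forall>A\<in>G. is_formula L A \<Longrightarrow> is_term L t \<longleftrightarrow> is_term L u"
  by (induction rule: eqv.induct) (auto simp: is_term_def is_formula_def)


section \<open>A one-sided calculus\<close>

text \<open>The sign of a formula is the side of the sequent that it stands on.\<close>

datatype 'a signed = is_Left: Left (unsigned: 'a) | Right (unsigned: 'a)

definition lefts :: "'a signed multiset \<Rightarrow> 'a set" where
  "lefts S = {A. Left A \<in># S}"

fun rank_signed :: "('f, 'p) fm signed \<Rightarrow> nat" where
  "rank_signed (Left A) = rank A"
| "rank_signed (Right A) = rank A"

text \<open>
  The parameter \<open>cl\<close> stands for classical logic. In intuitionistic and minimal logic, the right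
  rules for implication and universal quantification discard the rest of the succedent.
\<close>

fun one_sided :: "bool \<Rightarrow> ('f, 'p) fm signed \<Rightarrow> bool" where
  "one_sided cl (Right (Imp A B)) \<longleftrightarrow> \<not> cl"
| "one_sided cl (Right (Forall x A)) \<longleftrightarrow> \<not> cl"
| "one_sided cl _ \<longleftrightarrow> False"

text \<open>
  The part of the context \<open>S\<close> that reaches the premisses of a rule with principal formula \<open>\<phi>\<close>.
\<close>

definition ctx ::
  "bool \<Rightarrow> ('f, 'p) fm signed \<Rightarrow> ('f, 'p) fm signed multiset \<Rightarrow> ('f, 'p) fm signed multiset" where
  "ctx cl \<phi> S = (if one_sided cl \<phi> then filter_mset is_Left S else S)"

lemma one_sidedD: "one_sided cl \<phi> \<Longrightarrow> \<not> cl \<and> \<not> is_Left \<phi>"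
  by (cases "(cl, \<phi>)" rule: one_sided.cases) auto

lemma ctx_union [simp]: "ctx cl \<phi> (S + S') = ctx cl \<phi> S + ctx cl \<phi> S'"
  by (simp add: ctx_def)

lemma set_ctx_insert:
  "set_mset S \<subseteq> insert \<phi> (set_mset S') \<Longrightarrow>
    set_mset (ctx cl \<psi> S) \<subseteq> insert \<phi> (set_mset (ctx cl \<psi> S'))"
  by (auto simp: ctx_def)

lemma lefts_ctx [simp]: "lefts (ctx cl \<phi> S) = lefts S"
  by (auto simp: lefts_def ctx_def)

lemma lefts_mono: "set_mset S \<subseteq> set_mset S' \<Longrightarrow> lefts S \<subseteq> lefts S'"
  by (auto simp: lefts_def)

text \<open>
  The parameter \<open>efq\<close> stands for ex falso quodlibet: it tells whether falsum in the antecedent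
  suffices for an initial sequent.
\<close>

locale sequent_calculus =
  fixes L :: "('f, 'p) language" and cl :: bool and efq :: bool
begin

text \<open>
  \<open>inst \<phi> ps\<close> is a rule instance with principal formula \<open>\<phi>\<close>; the members of \<open>ps\<close> are what replaces
  \<open>\<phi>\<close> in the several premisses. There are infinitely many premisses where the given calculi have
  an eigenvariable.
\<close>

inductive inst :: "('f, 'p) fm signed \<Rightarrow> ('f, 'p) fm signed multiset set \<Rightarrow> bool" where
  Left_Conj: "inst (Left (Conj A B)) {{#Left A, Left B#}}"
| Right_Conj: "inst (Right (Conj A B)) {{#Right A#}, {#Right B#}}"
| Left_Disj: "inst (Left (Disj A B)) {{#Left A#}, {#Left B#}}"
| Right_Disj: "inst (Right (Disj A B)) {{#Right A, Right B#}}"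
| Left_Imp: "inst (Left (Imp A B))
    {(if cl then {#Right A#} else {#Right A, Left (Imp A B)#}), {#Left B#}}"
| Right_Imp: "inst (Right (Imp A B)) {{#Left A, Right B#}}"
| Left_Forall: "is_term L t \<Longrightarrow>
    inst (Left (Forall x A)) {{#Left (subst A x t), Left (Forall x A)#}}"
| Right_Forall: "inst (Right (Forall x A)) {{#Right (subst A x t)#} | t. is_term L t}"
| Left_Exists: "inst (Left (Exists x A)) {{#Left (subst A x t)#} | t. is_term L t}"
| Right_Exists: "is_term L t \<Longrightarrow>
    inst (Right (Exists x A)) {{#Right (Exists x A), Right (subst A x t)#}}"

definition axiomatic :: "('f, 'p) fm signed multiset \<Rightarrow> bool" where
  "axiomatic S \<longleftrightarrow> (\<exists>A. Right A \<in># S \<and> entails (lefts S) A) \<or> (efq \<and> Left Bot \<in># S)"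

inductive der :: "('f, 'p) fm signed multiset \<Rightarrow> bool" where
  axiomatic: "axiomatic S \<Longrightarrow> der S"
| rule: "inst \<phi> ps \<Longrightarrow> (\<And>X. X \<in> ps \<Longrightarrow> der (X + ctx cl \<phi> S)) \<Longrightarrow> der (add_mset \<phi> S)"

subsection \<open>Weakening, inversion, contraction\<close>

lemma axiomatic_mono: "axiomatic S \<Longrightarrow> set_mset S \<subseteq> set_mset S' \<Longrightarrow> axiomatic S'"
  unfolding axiomatic_def using entails_mono[OF _ lefts_mono] by (meson subsetD)

lemma weakening: "der S \<Longrightarrow> der (S + W)"
proof (induction arbitrary: W rule: der.induct)
  case (axiomatic S)
  show ?case by (rule der.axiomatic, rule axiomatic_mono[OF axiomatic]) auto
next
  case (rule \<phi> ps S)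
  have "der (add_mset \<phi> (S + W))"
  proof (rule der.rule[OF rule.hyps(1)])
    fix X assume "X \<in> ps"
    then show "der (X + ctx cl \<phi> (S + W))"
      using rule.IH[of X "ctx cl \<phi> W"] by (simp add: add.assoc)
  qed
  then show ?case by simp
qed

lemma weakening_subseteq: "der S \<Longrightarrow> S \<subseteq># S' \<Longrightarrow> der S'"
  using weakening by (metis subset_mset.add_diff_inverse)

text \<open>
  Compound formulas contribute nothing to an initial sequent.
\<close>

lemma inst_not_axiomatic:
  assumes "inst \<phi> ps" and "axiomatic (add_mset \<phi> S)"
  shows "axiomatic S"
proof -
  have 1: "\<phi> \<noteq> Left Bot" using assms(1) by (auto elim: inst.cases)
  have eqv: "eqv (lefts (add_mset \<phi> S)) t u \<Longrightarrow> eqv (lefts S) t u" for t u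
    by (induction rule: eqv.induct)
      (use assms(1) in \<open>auto simp: lefts_def intro: eqv.intros elim: inst.cases\<close>)
  have ent: "entails (lefts S) A" if "entails (lefts (add_mset \<phi> S)) A" for A
    using that
  proof cases
    case (Pred p ts us)
    have "list_all2 (eqv (lefts S)) ts us"
      using Pred(3) by (rule list_all2_mono) (rule eqv)
    moreover have "Pred p ts \<in> lefts S"
      using Pred(2) assms(1) by (auto simp: lefts_def elim: inst.cases)
    ultimately show ?thesis using Pred(1) by (auto intro: entails.Pred)
  next
    case (Eq t u)
    then show ?thesis by (auto intro: entails.Eq eqv)
  next
    case Bot
    with 1 show ?thesis by (auto simp: lefts_def intro: entails.Bot)
  qed
  have "\<not> entails G A" if "\<phi> = Right A" for G A
    using assms(1) that by (auto elim!: inst.cases entails.cases)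
  then show ?thesis
    using assms(2) 1 ent unfolding axiomatic_def by auto
qed

text \<open>
  A principal formula determines its rule instance, except for the choice of a term in those
  quantifier rules that repeat the principal formula in the premiss.
\<close>

lemma inst_unique:
  "inst \<phi> ps \<Longrightarrow> inst \<phi> qs \<Longrightarrow> X \<in> ps \<Longrightarrow> \<phi> \<notin># X \<Longrightarrow> X \<in> qs"
  by (erule inst.cases; erule inst.cases) (auto split: if_splits)

text \<open>
  Without classical logic, only implication moves a formula to the other side; on the left this
  happens in the premiss that repeats the implication, and on the right in a rule that discards
  the succedent. This is why inversion commutes with the discarding of the succedent.
\<close>

lemma inst_same_side:
  "inst \<phi> ps \<Longrightarrow> \<not> one_sided cl \<phi> \<Longrightarrow> X \<in> ps \<Longrightarrow> \<phi> \<notin># X \<Longrightarrow> \<not> cl \<Longrightarrow>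
     \<psi> \<in># X \<Longrightarrow> is_Left \<psi> = is_Left \<phi>"
  by (erule inst.cases) auto

lemma inst_rank:
  "inst \<phi> ps \<Longrightarrow> X \<in> ps \<Longrightarrow> \<psi> \<in># X \<Longrightarrow> rank_signed \<psi> < rank_signed \<phi> \<or> \<psi> = \<phi>"
  by (erule inst.cases) (auto split: if_splits)

text \<open>
  A premiss that repeats \<open>\<phi>\<close> follows by weakening. Otherwise \<open>\<phi>\<close> is followed up the derivation
  to where it is principal, discarded, or part of an initial sequent.
\<close>

lemma inversion:
  assumes "inst \<phi> ps" and "\<not> one_sided cl \<phi>" and "X \<in> ps" and "der (add_mset \<phi> S)"
  shows "der (X + S)"
proof (cases "\<phi> \<in># X")
  case True
  then obtain X' where "X = add_mset \<phi> X'" by (metis multi_member_split)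
  then show ?thesis using weakening[OF assms(4), of X'] by (simp add: ac_simps)
next
  case False
  have "der M \<Longrightarrow> M = add_mset \<phi> S \<Longrightarrow> der (X + S)" for M
  proof (induction arbitrary: S rule: der.induct)
    case (axiomatic M)
    then have "axiomatic S" using inst_not_axiomatic[OF assms(1)] by simp
    then show ?case by (intro der.axiomatic) (rule axiomatic_mono, auto)
  next
    case (rule \<psi> qs M)
    show ?case
    proof (cases "\<psi> = \<phi>")
      case True
      then have "M = S" and "X \<in> qs"
        using rule.prems inst_unique[OF assms(1) _ assms(3) False] rule.hyps(1) by auto
      then show ?thesis
        using rule.hyps(2)[of X] True assms(2) by (simp add: ctx_def)
    next
      case ne: False
      then obtain S1 where S1: "M = add_mset \<phi> S1" "S = add_mset \<psi> S1"
        using rule.prems by (auto simp: add_eq_conv_ex)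
      have "der (add_mset \<psi> (X + S1))"
      proof (rule der.rule[OF rule.hyps(1)])
        fix Y assume Y: "Y \<in> qs"
        show "der (Y + ctx cl \<psi> (X + S1))"
        proof (cases "one_sided cl \<psi> \<and> \<not> is_Left \<phi>")
          \<comment> \<open>The rule discards \<open>\<phi>\<close>, hence its premiss can only be weakened.\<close>
          case True
          then have "ctx cl \<psi> M = ctx cl \<psi> S1" by (simp add: S1 ctx_def)
          with rule.hyps(2)[OF Y] show ?thesis
            by (auto intro: weakening_subseteq[OF rule.hyps(2)[OF Y]])
        next
          case False
          then have "ctx cl \<psi> M = add_mset \<phi> (ctx cl \<psi> S1)" by (auto simp: S1 ctx_def)
          moreover have "ctx cl \<psi> X = X"
          proof (cases "one_sided cl \<psi>")
            case True
            have "is_Left \<chi>" if "\<chi> \<in># X" for \<chi>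
              using inst_same_side[OF assms(1-3) \<open>\<phi> \<notin># X\<close> _ that] one_sidedD[OF True] True False
              by blast
            then show ?thesis by (simp add: ctx_def filter_mset_eq_conv)
          qed (simp add: ctx_def)
          ultimately show ?thesis
            using rule.IH[OF Y, of "Y + ctx cl \<psi> S1"] by (simp add: ac_simps)
        qed
      qed
      then show ?thesis by (simp add: S1)
    qed
  qed
  then show ?thesis using assms(4) by blast
qed

lemma contraction_mset:
  assumes "\<And>\<psi> S. \<psi> \<in># Y \<Longrightarrow> der (add_mset \<psi> (add_mset \<psi> S)) \<Longrightarrow> der (add_mset \<psi> S)"
    and "der (Y + Y + S)"
  shows "der (Y + S)"
  using assms
proof (induction Y arbitrary: S)
  case (add \<psi> Y)
  have "der (add_mset \<psi> (add_mset \<psi> (Y + Y + S)))" using add.prems(2) by simp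
  then have "der (add_mset \<psi> (Y + Y + S))" by (rule add.prems(1)[rotated]) simp
  then have d: "der (Y + Y + add_mset \<psi> S)" by simp
  have "der (Y + add_mset \<psi> S)"
  proof (rule add.IH[OF _ d])
    fix \<chi> S' assume "\<chi> \<in># Y" and "der (add_mset \<chi> (add_mset \<chi> S'))"
    then show "der (add_mset \<chi> S')" using add.prems(1)[of \<chi> S'] by auto
  qed
  then show ?case by simp
qed simp

text \<open>
  Two copies of a principal formula: a premiss that repeats the formula still has two copies, to
  which the inner induction applies. Any other premiss is inverted at the second copy,
  which yields two copies of formulas of smaller rank. If the rule discards the succedent, it
  discards the second copy too, and inversion is not called for.
\<close>

lemma contraction: "der (add_mset \<phi> (add_mset \<phi> S)) \<Longrightarrow> der (add_mset \<phi> S)"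
proof (induction "rank_signed \<phi>" arbitrary: \<phi> S rule: less_induct)
  case less
  have "der M \<Longrightarrow> M = add_mset \<phi> (add_mset \<phi> S) \<Longrightarrow> der (add_mset \<phi> S)" for M
  proof (induction arbitrary: S rule: der.induct)
    case (axiomatic M)
    show ?case
      by (rule der.axiomatic, rule axiomatic_mono[OF axiomatic(1)]) (simp add: axiomatic(2))
  next
    case (rule \<psi> qs M)
    show ?case
    proof (cases "\<psi> = \<phi>")
      case True
      with rule.prems have M: "M = add_mset \<phi> S" by simp
      show ?thesis
      proof (rule der.rule[OF rule.hyps(1)[unfolded True]])
        fix Y assume Y: "Y \<in> qs"
        show "der (Y + ctx cl \<phi> S)"
        proof (cases "one_sided cl \<phi>")
          case r: True
          with one_sidedD[OF r] show ?thesis using rule.hyps(2)[OF Y] True by (simp add: M ctx_def)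
        next
          case nr: False
          then have d: "der (Y + add_mset \<phi> S)"
            using rule.hyps(2)[OF Y] True by (simp add: M ctx_def)
          have "der (Y + S)"
          proof (cases "\<phi> \<in># Y")
            case kept: True
            then obtain Y' where Y': "Y = add_mset \<phi> Y'" by (metis multi_member_split)
            show ?thesis
              using rule.IH[OF Y, of "Y' + S"] True nr by (simp add: M Y' ctx_def)
          next
            case nk: False
            have "der (add_mset \<phi> (Y + S))" using d by simp
            then have "der (Y + (Y + S))"
              using inversion[OF _ nr Y] rule.hyps(1) True by blast
            then have "der (Y + Y + S)" by (simp add: add.assoc)
            moreover have "rank_signed \<psi> < rank_signed \<phi>" if "\<psi> \<in># Y" for \<psi>
              using inst_rank[OF rule.hyps(1)[unfolded True] Y that] nk that by auto
            ultimately show ?thesis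
              using less.hyps by (metis contraction_mset)
          qed
          then show ?thesis using nr by (simp add: ctx_def)
        qed
      qed
    next
      case False
      then obtain S1 where S1: "M = add_mset \<phi> (add_mset \<phi> S1)" "S = add_mset \<psi> S1"
        using rule.prems by (auto simp: add_eq_conv_ex)
      have "der (add_mset \<psi> (add_mset \<phi> S1))"
      proof (rule der.rule[OF rule.hyps(1)])
        fix Y assume Y: "Y \<in> qs"
        show "der (Y + ctx cl \<psi> (add_mset \<phi> S1))"
        proof (cases "one_sided cl \<psi> \<and> \<not> is_Left \<phi>")
          case True
          then show ?thesis using rule.hyps(2)[OF Y] by (simp add: S1 ctx_def)
        next
          case False
          then have "ctx cl \<psi> M = add_mset \<phi> (add_mset \<phi> (ctx cl \<psi> S1))"
            and "ctx cl \<psi> (add_mset \<phi> S1) = add_mset \<phi> (ctx cl \<psi> S1)"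
            by (auto simp: S1 ctx_def)
          then show ?thesis using rule.IH[OF Y, of "Y + ctx cl \<psi> S1"] by simp
        qed
      qed
      then show ?thesis by (simp add: S1 add_mset_commute)
    qed
  qed
  then show ?case using less.prems by blast
qed

lemma contract_members: "der (X + S) \<Longrightarrow> set_mset X \<subseteq> set_mset S \<Longrightarrow> der S"
proof (induction X)
  case (add \<phi> X)
  then obtain S' where S': "S = add_mset \<phi> S'" by (metis insert_subset mset_add set_mset_add_mset_insert)
  have "der (add_mset \<phi> (add_mset \<phi> (X + S')))" using add.prems S' by simp
  then have "der (add_mset \<phi> (X + S'))" by (rule contraction)
  then have "der (X + S)" by (simp add: S')
  then show ?case by (rule add.IH) (use add.prems in simp)
qed simp

lemma der_mono: "der S \<Longrightarrow> set_mset S \<subseteq> set_mset S' \<Longrightarrow> der S'"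
  using weakening contract_members by blast

text \<open>
  Backward application of a rule that leaves the principal formula in the context, as
  is convenient when multisets are handled like sets.
\<close>

lemma rule_kept:
  assumes "inst \<phi> ps" and "\<phi> \<in># S" and "\<And>X. X \<in> ps \<Longrightarrow> der (X + ctx cl \<phi> S)"
  shows "der S"
proof -
  have "der (add_mset \<phi> S)" using assms(1,3) by (rule der.rule)
  then show ?thesis by (rule der_mono) (use assms(2) in auto)
qed

subsection \<open>Cut\<close>

text \<open>
  Cut on an atom or falsum. Such a formula is never principal in the right premiss, so that it can
  be deleted all the way up; at the leaves it is absorbed by transitivity of entailment.
\<close>

lemma discharge_entailed:
  assumes "der N" and "set_mset N \<subseteq> insert (Left A) (set_mset S)" and "entails (lefts S) A"
  shows "der S"
  using assms
proof (induction arbitrary: S rule: der.induct)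
  case (axiomatic N)
  have sub: "lefts N \<subseteq> insert A (lefts S)" using axiomatic.prems(1) by (auto simp: lefts_def)
  have "axiomatic S"
    using axiomatic.hyps unfolding axiomatic_def
  proof (elim disjE exE conjE)
    fix B assume B: "Right B \<in># N" "entails (lefts N) B"
    then have "entails (lefts S) B"
      using entails_cut[OF axiomatic.prems(2) entails_mono[OF _ sub]] by blast
    moreover have "Right B \<in># S" using B(1) axiomatic.prems(1) by auto
    ultimately show "(\<exists>A. Right A \<in># S \<and> entails (lefts S) A) \<or> efq \<and> Left Bot \<in># S" by blast
  next
    assume efq and "Left Bot \<in># N"
    then show "(\<exists>A. Right A \<in># S \<and> entails (lefts S) A) \<or> efq \<and> Left Bot \<in># S"
      using axiomatic.prems by (auto simp: lefts_def elim: entails_BotE)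
  qed
  then show ?case by (rule der.axiomatic)
next
  case (rule \<psi> qs N)
  have "\<psi> \<noteq> Left A"
    using rule.hyps(1) rule.prems(2) by (auto elim!: inst.cases entails.cases)
  then have "\<psi> \<in># S" using rule.prems(1) by auto
  with rule.hyps(1) show ?case
  proof (rule rule_kept)
    fix Y assume Y: "Y \<in> qs"
    show "der (Y + ctx cl \<psi> S)"
    proof (rule rule.IH[OF Y])
      show "set_mset (Y + ctx cl \<psi> N) \<subseteq> insert (Left A) (set_mset (Y + ctx cl \<psi> S))"
        using rule.prems(1) set_ctx_insert[of N "Left A" S cl \<psi>] by auto
      have "lefts S \<subseteq> lefts (Y + ctx cl \<psi> S)" by (metis lefts_ctx lefts_mono set_mset_union sup_ge2)
      then show "entails (lefts (Y + ctx cl \<psi> S)) A"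
        using rule.prems(2) entails_mono by blast
    qed
  qed
qed

definition cuttable :: "('f, 'p) fm \<Rightarrow> bool" where
  "cuttable A \<longleftrightarrow> (\<forall>S. der (add_mset (Right A) S) \<longrightarrow> der (add_mset (Left A) S) \<longrightarrow> der S)"

lemma cuttableD: "cuttable A \<Longrightarrow> der (add_mset (Right A) S) \<Longrightarrow> der (add_mset (Left A) S) \<Longrightarrow> der S"
  by (simp add: cuttable_def)

text \<open>
  The case in which the cut formula is principal in both premisses. The filters delete the copy
  that some rules repeat in their premisses: its removal is the task of cuts made beforehand.
\<close>

lemma principal_cut:
  assumes "inst (Right A) ps" and "inst (Left A) qs"
    and "\<And>Y. Y \<in> ps \<Longrightarrow> der (filter_mset (\<lambda>\<psi>. \<psi> \<noteq> Right A) Y + S)"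
    and "\<And>Y. Y \<in> qs \<Longrightarrow> der (filter_mset (\<lambda>\<psi>. \<psi> \<noteq> Left A) Y + S)"
    and smaller: "\<And>B. rank B < rank A \<Longrightarrow> cuttable B"
  shows "der S"
  using assms(1)
proof cases
  case (Right_Conj B C)
  then have c: "cuttable B" "cuttable C" by (auto intro: smaller)
  have "qs = {{#Left B, Left C#}}" using assms(2) Right_Conj by (auto elim: inst.cases)
  then have l: "der (add_mset (Left B) (add_mset (Left C) S))"
    using assms(4) Right_Conj by auto
  have rB: "der (add_mset (Right B) S)" and rC: "der (add_mset (Right C) S)"
    using assms(3)[of "{#Right B#}"] assms(3)[of "{#Right C#}"] Right_Conj by auto
  have "der (add_mset (Right B) (add_mset (Left C) S))" by (rule der_mono[OF rB]) auto
  then have "der (add_mset (Left C) S)" using l by (rule cuttableD[OF c(1)])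
  with rC show ?thesis by (rule cuttableD[OF c(2)])
next
  case (Right_Disj B C)
  then have c: "cuttable B" "cuttable C" by (auto intro: smaller)
  have "qs = {{#Left B#}, {#Left C#}}" using assms(2) Right_Disj by (auto elim: inst.cases)
  then have lB: "der (add_mset (Left B) S)" and lC: "der (add_mset (Left C) S)"
    using assms(4)[of "{#Left B#}"] assms(4)[of "{#Left C#}"] Right_Disj by auto
  have r: "der (add_mset (Right B) (add_mset (Right C) S))" using assms(3) Right_Disj by auto
  have "der (add_mset (Left B) (add_mset (Right C) S))" by (rule der_mono[OF lB]) auto
  with r have "der (add_mset (Right C) S)" by (rule cuttableD[OF c(1)])
  then show ?thesis using lC by (rule cuttableD[OF c(2)])
next
  case (Right_Imp B C)
  then have c: "cuttable B" "cuttable C" by (auto intro: smaller)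
  have "\<exists>X. X \<in> qs \<and> filter_mset (\<lambda>\<psi>. \<psi> \<noteq> Left A) X = {#Right B#}"
    and "\<exists>X. X \<in> qs \<and> filter_mset (\<lambda>\<psi>. \<psi> \<noteq> Left A) X = {#Left C#}"
    using assms(2) Right_Imp(1) by (auto elim!: inst.cases)
  then have l: "der (add_mset (Right B) S)" and r: "der (add_mset (Left C) S)"
    using assms(4) by (metis add_mset_add_single union_commute)+
  have m: "der (add_mset (Left B) (add_mset (Right C) S))" using assms(3) Right_Imp by auto
  have "der (add_mset (Right B) (add_mset (Right C) S))" by (rule der_mono[OF l]) auto
  then have "der (add_mset (Right C) S)" using m by (rule cuttableD[OF c(1)])
  then show ?thesis using r by (rule cuttableD[OF c(2)])
next
  case (Right_Forall x B)
  obtain t where t: "is_term L t" and qs: "qs = {{#Left (subst B x t), Left A#}}"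
    using assms(2) Right_Forall by (auto elim: inst.cases)
  have r: "der (add_mset (Right (subst B x t)) S)"
    using assms(3)[of "{#Right (subst B x t)#}"] Right_Forall t by auto
  have l: "der (add_mset (Left (subst B x t)) S)"
    using assms(4) qs Right_Forall by auto
  have c: "cuttable (subst B x t)" using Right_Forall by (auto intro: smaller)
  show ?thesis using c r l by (rule cuttableD)
next
  case (Right_Exists t x B)
  have qs: "qs = {{#Left (subst B x t)#} | t. is_term L t}"
    using assms(2) Right_Exists by (auto elim: inst.cases)
  have r: "der (add_mset (Right (subst B x t)) S)" using assms(3) Right_Exists by auto
  have l: "der (add_mset (Left (subst B x t)) S)"
    using assms(4)[of "{#Left (subst B x t)#}"] Right_Exists qs by auto
  have c: "cuttable (subst B x t)" using Right_Exists by (auto intro: smaller)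
  show ?thesis using c r l by (rule cuttableD)
qed

text \<open>
  If \<open>A\<close> is compound, then it is principal in some rule on the left; for a universal formula this
  needs a term, and variables are terms.
\<close>

lemma exists_inst_Left:
  assumes "inst (Right A) ps"
  obtains qs where "inst (Left A) qs"
proof -
  have "\<exists>qs. inst (Left A) qs"
    using assms by cases (blast intro: inst.intros is_term_FVar)+
  then show ?thesis using that by blast
qed

lemma inst_Left_repeated:
  assumes "inst (Left A) qs" and "Y \<in> qs" and "Left A \<in># Y"
  shows "one_sided cl (Right A) \<or> cl"
  using assms(1) by cases (use assms(2,3) in auto)

text \<open>
  The cut formula \<open>A\<close> is principal in the left premiss, and the cut is moved up the derivation
  \<open>N\<close> of the right premiss. The premisses \<open>ps\<close> of the left derivation must remain available while
  rules of \<open>N\<close> discard succedents. In classical logic nothing is ever discarded, and otherwise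
  the last rule of the left derivation has itself discarded its succedent already. This is the
  assumption on \<open>A\<close>.
\<close>

lemma cut_left_premiss_kept:
  assumes "der N" and "set_mset N \<subseteq> insert (Left A) (set_mset S)"
    and ps: "inst (Right A) ps" "\<not> cl \<longrightarrow> one_sided cl (Right A)"
    and "\<And>Y. Y \<in> ps \<Longrightarrow> der (filter_mset (\<lambda>\<psi>. \<psi> \<noteq> Right A) Y + ctx cl (Right A) S)"
    and smaller: "\<And>B. rank B < rank A \<Longrightarrow> cuttable B"
  shows "der S"
  using assms(1,2,5)
proof (induction arbitrary: S rule: der.induct)
  case (axiomatic N)
  have "axiomatic (add_mset (Left A) S)"
    by (rule axiomatic_mono[OF axiomatic.hyps]) (use axiomatic.prems(1) in simp)
  moreover obtain qs where "inst (Left A) qs"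
    using ps(1) by (rule exists_inst_Left)
  ultimately have "axiomatic S" using inst_not_axiomatic by blast
  then show ?case by (rule der.axiomatic)
next
  case (rule \<psi> qs N)
  have ctx: "set_mset (ctx cl (Right A) S) \<subseteq> set_mset (ctx cl (Right A) (Z + ctx cl \<psi> S))" for Z
  proof (cases "one_sided cl (Right A)")
    case True
    then show ?thesis by (auto simp: ctx_def)
  next
    case False
    with ps(2) have "\<not> one_sided cl \<psi>" using one_sidedD by blast
    with False show ?thesis by (simp add: ctx_def)
  qed
  have left: "der (filter_mset (\<lambda>\<psi>. \<psi> \<noteq> Right A) Y + ctx cl (Right A) (Z + ctx cl \<psi> S))"
    if "Y \<in> ps" for Y Z
    by (rule der_mono[OF rule.prems(2)[OF that]]) (use ctx[of Z] in auto)
  show ?case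
  proof (cases "\<psi> \<in># S")
    case True
    with rule.hyps(1) show ?thesis
    proof (rule rule_kept)
      fix Y assume Y: "Y \<in> qs"
      show "der (Y + ctx cl \<psi> S)"
      proof (rule rule.IH[OF Y])
        show "set_mset (Y + ctx cl \<psi> N) \<subseteq> insert (Left A) (set_mset (Y + ctx cl \<psi> S))"
          using rule.prems(1) set_ctx_insert[of N "Left A" S cl \<psi>] by auto
      qed (rule left)
    qed
  next
    case False
    then have \<psi>: "\<psi> = Left A" using rule.prems(1) by auto
    show ?thesis
    proof (rule principal_cut[OF ps(1) rule.hyps(1)[unfolded \<psi>] _ _ smaller])
      fix Y assume "Y \<in> ps"
      then show "der (filter_mset (\<lambda>\<psi>. \<psi> \<noteq> Right A) Y + S)"
        by (rule der_mono[OF rule.prems(2)]) (auto simp: ctx_def split: if_splits)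
    next
      fix Y assume Y: "Y \<in> qs"
      show "der (filter_mset (\<lambda>\<psi>. \<psi> \<noteq> Left A) Y + S)"
      proof (rule rule.IH[OF Y])
        show "set_mset (Y + ctx cl \<psi> N) \<subseteq>
          insert (Left A) (set_mset (filter_mset (\<lambda>\<psi>. \<psi> \<noteq> Left A) Y + S))"
          using rule.prems(1) \<psi> by (auto simp: ctx_def)
      next
        fix Z assume "Z \<in> ps"
        then show "der (filter_mset (\<lambda>\<psi>. \<psi> \<noteq> Right A) Z +
            ctx cl (Right A) (filter_mset (\<lambda>\<psi>. \<psi> \<noteq> Left A) Y + S))"
          using left[of Z "filter_mset (\<lambda>\<psi>. \<psi> \<noteq> Left A) Y"] \<psi> by (simp add: ctx_def)
      qed
    qed
  qed
qed

text \<open>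
  The cut is moved up the derivation of the left premiss until \<open>A\<close> is principal there or occurs in
  an initial sequent. A principal \<open>A\<close> is then traced in the right premiss as well. In
  intuitionistic and minimal logic this fails for conjunctions, disjunctions and existential
  formulas, as a rule of the right premiss may discard a succedent that the left premiss needs.
  But their left rules are invertible, which provides the premisses of a principal cut at once.
\<close>

lemma cut_smaller_ranks:
  assumes "der M" and "set_mset M \<subseteq> insert (Right A) (set_mset S)" and "der (add_mset (Left A) S)"
    and smaller: "\<And>B. rank B < rank A \<Longrightarrow> cuttable B"
  shows "der S"
  using assms(1-3)
proof (induction arbitrary: S rule: der.induct)
  case (axiomatic M)
  have sub: "lefts M \<subseteq> lefts S" using axiomatic.prems(1) by (auto simp: lefts_def)
  show ?case
  proof (cases "entails (lefts S) A")
    case True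
    show ?thesis by (rule discharge_entailed[OF axiomatic.prems(2) _ True]) simp
  next
    case False
    have "axiomatic S"
      using axiomatic.hyps axiomatic.prems(1) False entails_mono[OF _ sub]
      unfolding axiomatic_def by auto
    then show ?thesis by (rule der.axiomatic)
  qed
next
  case (rule \<psi> ps M)
  \<comment> \<open>The right premiss stays the same throughout, up to weakening.\<close>
  have right: "der (add_mset (Left A) (Y + S))" for Y
    by (rule der_mono[OF rule.prems(2)]) auto
  show ?case
  proof (cases "\<psi> \<in># S")
    case True
    with rule.hyps(1) show ?thesis
    proof (rule rule_kept)
      fix Y assume Y: "Y \<in> ps"
      show "der (Y + ctx cl \<psi> S)"
      proof (cases "one_sided cl \<psi>")
        case True
        show ?thesis
          by (rule der_mono[OF rule.hyps(2)[OF Y]]) (use True rule.prems(1) in \<open>auto simp: ctx_def\<close>)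
      next
        case False
        show ?thesis
          by (rule rule.IH[OF Y]) (use False rule.prems(1) right[of Y] in \<open>auto simp: ctx_def\<close>)
      qed
    qed
  next
    case False
    then have \<psi>: "\<psi> = Right A" using rule.prems(1) by auto
    note ps = rule.hyps(1)[unfolded \<psi>]
    \<comment> \<open>A rule that discards the succedent has discarded the other copies of \<open>A\<close>;
      otherwise they are removed by the induction hypothesis.\<close>
    let ?rest = "filter_mset (\<lambda>\<psi>. \<psi> \<noteq> Right A)"
    have left: "der (?rest Y + ctx cl (Right A) S)" if Y: "Y \<in> ps" for Y
    proof (cases "one_sided cl (Right A)")
      case True
      have "\<psi> \<notin># Y" using ps True Y \<psi> by (auto elim!: inst.cases)
      show ?thesis
        by (rule der_mono[OF rule.hyps(2)[OF Y]])
          (use \<open>\<psi> \<notin># Y\<close> True \<psi> rule.prems(1) in \<open>auto simp: ctx_def\<close>)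
    next
      case False
      have "der (?rest Y + S)"
        by (rule rule.IH[OF Y])
          (use rule.prems(1) right[of "?rest Y"] False \<psi> in \<open>auto simp: ctx_def\<close>)
      with False show ?thesis by (simp add: ctx_def)
    qed
    show ?thesis
    proof (cases "cl \<or> one_sided cl (Right A)")
      case True
      show ?thesis
        by (rule cut_left_premiss_kept[OF rule.prems(2) _ ps _ left smaller]) (use True in auto)
    next
      case False
      obtain qs where qs: "inst (Left A) qs" using ps by (rule exists_inst_Left)
      show ?thesis
      proof (rule principal_cut[OF ps qs _ _ smaller])
        fix Y assume "Y \<in> ps"
        moreover have "\<not> one_sided cl (Right A)" using False by blast
        then have "ctx cl (Right A) S = S" by (simp add: ctx_def)
        ultimately show "der (?rest Y + S)" using left by metis
      next
        fix Y assume Y: "Y \<in> qs"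
        have "Left A \<notin># Y" using inst_Left_repeated[OF qs Y] False by blast
        then have "filter_mset (\<lambda>\<psi>. \<psi> \<noteq> Left A) Y = Y"
          by (auto simp: filter_mset_eq_conv)
        moreover have "der (Y + S)" using inversion[OF qs _ Y rule.prems(2)] by simp
        ultimately show "der (filter_mset (\<lambda>\<psi>. \<psi> \<noteq> Left A) Y + S)" by simp
      qed
    qed
  qed
qed

lemma cut: "cuttable A"
proof (induction "rank A" arbitrary: A rule: less_induct)
  case less
  show ?case
    unfolding cuttable_def
  proof (intro allI impI)
    fix S assume r: "der (add_mset (Right A) S)" and l: "der (add_mset (Left A) S)"
    show "der S" by (rule cut_smaller_ranks[OF r _ l less]) auto
  qed
qed

subsection \<open>Substitution\<close>

text \<open>
  Substitution in a rule instance. In the rules with a premiss for every term, the substituted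
  instance has premisses whose term does not have the form \<open>fsubst_tm \<sigma> t\<close>; such a premiss arises
  from a fresh variable by a different substitution \<open>\<tau>\<close>. The set \<open>V\<close> serves to make \<open>\<tau>\<close> agree with \<open>\<sigma>\<close>
  on the context.
\<close>

lemma inst_fsubst:
  assumes "inst \<phi> ps" and "finite V" and \<sigma>: "\<And>a. is_term L (\<sigma> a)"
  shows "\<exists>ps'. inst (map_signed (fsubst \<sigma>) \<phi>) ps' \<and>
    (\<forall>Y'\<in>ps'. \<exists>Y\<in>ps. \<exists>\<tau>. (\<forall>a. is_term L (\<tau> a)) \<and> (\<forall>a\<in>V. \<tau> a = \<sigma> a) \<and>
      Y' = image_mset (map_signed (fsubst \<tau>)) Y)" (is ?goal)
proof -
  have same: ?goal
    if "inst (map_signed (fsubst \<sigma>) \<phi>) ((\<lambda>Y. image_mset (map_signed (fsubst \<sigma>)) Y) ` ps)"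
    using that \<sigma> by blast
  have fresh: "\<exists>\<tau> a. (\<forall>a. is_term L (\<tau> a)) \<and> (\<forall>a\<in>V. \<tau> a = \<sigma> a) \<and>
      fsubst \<tau> (subst A x (FVar a)) = subst (fsubst \<sigma> A) x t" if t: "is_term L t" for A x t
  proof -
    have "finite (V \<union> fv A)" using assms(2) by simp
    then obtain a where a: "a \<notin> V \<union> fv A" using ex_new_if_finite[OF infinite_UNIV_nat] by blast
    show ?thesis
      by (rule exI[of _ "\<sigma>(a := t)"], rule exI[of _ a])
        (use a \<sigma> t fsubst_fresh_subst[of L \<sigma> t a A x] in auto)
  qed
  show ?thesis
    using assms(1)
  proof cases
    case (Left_Forall t x A)
    have "inst (Left (Forall x (fsubst \<sigma> A))) {{#Left (subst (fsubst \<sigma> A) x (fsubst_tm \<sigma> t)), Left (Forall x (fsubst \<sigma> A))#}}"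
      by (rule inst.Left_Forall, rule is_term_fsubst_tm[OF \<sigma> Left_Forall(3)])
    then show ?thesis
      by (intro same) (simp add: Left_Forall(1,2) fsubst_subst[OF \<sigma>])
  next
    case (Right_Exists t x A)
    have "inst (Right (Exists x (fsubst \<sigma> A))) {{#Right (Exists x (fsubst \<sigma> A)), Right (subst (fsubst \<sigma> A) x (fsubst_tm \<sigma> t))#}}"
      by (rule inst.Right_Exists, rule is_term_fsubst_tm[OF \<sigma> Right_Exists(3)])
    then show ?thesis
      by (intro same) (simp add: Right_Exists(1,2) fsubst_subst[OF \<sigma>])
  next
    case (Right_Forall x A)
    have "\<exists>Y\<in>ps. \<exists>\<tau>. (\<forall>a. is_term L (\<tau> a)) \<and> (\<forall>a\<in>V. \<tau> a = \<sigma> a) \<and>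
        {#Right (subst (fsubst \<sigma> A) x t)#} = image_mset (map_signed (fsubst \<tau>)) Y"
      if t: "is_term L t" for t
    proof -
      obtain \<tau> a where \<tau>: "\<forall>a. is_term L (\<tau> a)" "\<forall>a\<in>V. \<tau> a = \<sigma> a"
        "fsubst \<tau> (subst A x (FVar a)) = subst (fsubst \<sigma> A) x t" using fresh[OF t] by blast
      have "{#Right (subst A x (FVar a))#} \<in> ps" using Right_Forall by auto
      moreover have "{#Right (subst (fsubst \<sigma> A) x t)#} =
          image_mset (map_signed (fsubst \<tau>)) {#Right (subst A x (FVar a))#}"
        using \<tau> by simp
      ultimately show ?thesis using \<tau>(1,2) by blast
    qed
    then show ?thesis
      using inst.Right_Forall[where x = x and A = "fsubst \<sigma> A"] Right_Forall(1)
      by (intro exI[of _ "{{#Right (subst (fsubst \<sigma> A) x t)#} | t. is_term L t}"] conjI) auto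
  next
    case (Left_Exists x A)
    have "\<exists>Y\<in>ps. \<exists>\<tau>. (\<forall>a. is_term L (\<tau> a)) \<and> (\<forall>a\<in>V. \<tau> a = \<sigma> a) \<and>
        {#Left (subst (fsubst \<sigma> A) x t)#} = image_mset (map_signed (fsubst \<tau>)) Y"
      if t: "is_term L t" for t
    proof -
      obtain \<tau> a where \<tau>: "\<forall>a. is_term L (\<tau> a)" "\<forall>a\<in>V. \<tau> a = \<sigma> a"
        "fsubst \<tau> (subst A x (FVar a)) = subst (fsubst \<sigma> A) x t" using fresh[OF t] by blast
      have "{#Left (subst A x (FVar a))#} \<in> ps" using Left_Exists by auto
      moreover have "{#Left (subst (fsubst \<sigma> A) x t)#} =
          image_mset (map_signed (fsubst \<tau>)) {#Left (subst A x (FVar a))#}"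
        using \<tau> by simp
      ultimately show ?thesis using \<tau>(1,2) by blast
    qed
    then show ?thesis
      using inst.Left_Exists[where x = x and A = "fsubst \<sigma> A"] Left_Exists(1)
      by (intro exI[of _ "{{#Left (subst (fsubst \<sigma> A) x t)#} | t. is_term L t}"] conjI) auto
  next
    case (Left_Conj A B)
    then show ?thesis
      using inst.Left_Conj[of "fsubst \<sigma> A" "fsubst \<sigma> B"] by (intro same) simp
  next
    case (Right_Conj A B)
    then show ?thesis
      using inst.Right_Conj[of "fsubst \<sigma> A" "fsubst \<sigma> B"] by (intro same) simp
  next
    case (Left_Disj A B)
    then show ?thesis
      using inst.Left_Disj[of "fsubst \<sigma> A" "fsubst \<sigma> B"] by (intro same) simp
  next
    case (Right_Disj A B)
    then show ?thesis
      using inst.Right_Disj[of "fsubst \<sigma> A" "fsubst \<sigma> B"] by (intro same) simp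
  next
    case (Left_Imp A B)
    then show ?thesis
      using inst.Left_Imp[of "fsubst \<sigma> A" "fsubst \<sigma> B"] by (intro same) (cases cl; simp)
  next
    case (Right_Imp A B)
    then show ?thesis
      using inst.Right_Imp[of "fsubst \<sigma> A" "fsubst \<sigma> B"] by (intro same) simp
  qed
qed

lemma one_sided_map [simp]: "one_sided cl (map_signed (fsubst \<sigma>) \<phi>) = one_sided cl \<phi>"
  by (cases "(cl, \<phi>)" rule: one_sided.cases) auto

lemma ctx_map: "ctx cl (map_signed (fsubst \<sigma>) \<phi>) (image_mset (map_signed (fsubst \<sigma>)) S)
    = image_mset (map_signed (fsubst \<sigma>)) (ctx cl \<phi> S)"
  by (auto simp: ctx_def filter_mset_image_mset)

fun fv_signed :: "('f, 'p) fm signed \<Rightarrow> nat set" where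
  "fv_signed (Left A) = fv A"
| "fv_signed (Right A) = fv A"

lemma map_signed_fsubst_cong:
  "(\<And>a. a \<in> fv_signed \<phi> \<Longrightarrow> \<sigma> a = \<tau> a) \<Longrightarrow> map_signed (fsubst \<sigma>) \<phi> = map_signed (fsubst \<tau>) \<phi>"
  by (cases \<phi>) (auto intro: fsubst_cong)

lemma der_fsubst:
  "der S \<Longrightarrow> (\<And>a. is_term L (\<sigma> a)) \<Longrightarrow> der (image_mset (map_signed (fsubst \<sigma>)) S)"
proof (induction arbitrary: \<sigma> rule: der.induct)
  case (axiomatic S)
  have "fsubst \<sigma> ` lefts S \<subseteq> lefts (image_mset (map_signed (fsubst \<sigma>)) S)"
    by (force simp: lefts_def)
  then have "entails (lefts S) A \<Longrightarrow>
      entails (lefts (image_mset (map_signed (fsubst \<sigma>)) S)) (fsubst \<sigma> A)" for A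
    using entails_fsubst entails_mono by blast
  with axiomatic.hyps have "axiomatic (image_mset (map_signed (fsubst \<sigma>)) S)"
    unfolding axiomatic_def by (force simp: image_iff)
  then show ?case by (rule der.axiomatic)
next
  case (rule \<phi> ps S)
  define V where "V = (\<Union>\<psi>\<in>set_mset S. fv_signed \<psi>)"
  have "finite (fv_signed \<psi>)" for \<psi> :: "('f, 'p) fm signed" by (cases \<psi>) auto
  then have "finite V" by (simp add: V_def)
  obtain ps' where ps': "inst (map_signed (fsubst \<sigma>) \<phi>) ps'"
    and Y: "\<forall>Y'\<in>ps'. \<exists>Y\<in>ps. \<exists>\<tau>. (\<forall>a. is_term L (\<tau> a)) \<and> (\<forall>a\<in>V. \<tau> a = \<sigma> a) \<and>
      Y' = image_mset (map_signed (fsubst \<tau>)) Y"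
    using inst_fsubst[of \<phi> ps V \<sigma>, OF rule.hyps(1) \<open>finite V\<close> rule.prems] by (elim exE conjE)
  have "der (add_mset (map_signed (fsubst \<sigma>) \<phi>) (image_mset (map_signed (fsubst \<sigma>)) S))"
    using ps'
  proof (rule der.rule)
    fix Y' assume "Y' \<in> ps'"
    then obtain Y \<tau> where Y: "Y \<in> ps" "\<And>a. is_term L (\<tau> a)" "\<And>a. a \<in> V \<Longrightarrow> \<tau> a = \<sigma> a"
      "Y' = image_mset (map_signed (fsubst \<tau>)) Y" using Y by blast
    have "image_mset (map_signed (fsubst \<sigma>)) (ctx cl \<phi> S) = image_mset (map_signed (fsubst \<tau>)) (ctx cl \<phi> S)"
      by (intro image_mset_cong map_signed_fsubst_cong)
        (auto simp: V_def ctx_def split: if_splits intro!: Y(3)[symmetric])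
    with rule.IH[OF Y(1,2)] show "der (Y' + ctx cl (map_signed (fsubst \<sigma>) \<phi>) (image_mset (map_signed (fsubst \<sigma>)) S))"
      by (simp add: ctx_map Y(4))
  qed
  then show ?case by simp
qed

text \<open>
  From one premiss with an eigenvariable to the premisses for all terms. Mapping over \<open>\<phi>\<close>
  covers both sides of the sequent.
\<close>

lemma der_eigenvariable:
  assumes "der (add_mset (map_signed (\<lambda>A. subst A x (FVar a)) \<phi>) S)"
    and "a \<notin> fv_signed \<phi>" and "\<And>\<psi>. \<psi> \<in># S \<Longrightarrow> a \<notin> fv_signed \<psi>" and "is_term L t"
  shows "der (add_mset (map_signed (\<lambda>A. subst A x t) \<phi>) S)"
proof -
  let ?\<sigma> = "FVar(a := t)"
  have "der (image_mset (map_signed (fsubst ?\<sigma>)) (add_mset (map_signed (\<lambda>A. subst A x (FVar a)) \<phi>) S))"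
    using assms(4) by (intro der_fsubst[OF assms(1)]) auto
  moreover have "map_signed (fsubst ?\<sigma>) (map_signed (\<lambda>A. subst A x (FVar a)) \<phi>)
      = map_signed (\<lambda>A. subst A x t) \<phi>"
    using assms(2) fsubst_fresh_subst[of L FVar t a _ x] assms(4) by (cases \<phi>) auto
  moreover have "map_signed (fsubst ?\<sigma>) \<psi> = \<psi>" if "\<psi> \<in># S" for \<psi>
  proof -
    have "map_signed (fsubst ?\<sigma>) \<psi> = map_signed (fsubst FVar) \<psi>"
      by (rule map_signed_fsubst_cong) (use assms(3)[OF that] in auto)
    then show ?thesis by (cases \<psi>) auto
  qed
  then have "image_mset (map_signed (fsubst ?\<sigma>)) S = S"
    by (metis (no_types, lifting) image_mset_cong multiset.map_ident)
  ultimately show ?thesis by simp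
qed

end

section \<open>Equivalence with the sequent calculi\<close>

definition sign :: "('f, 'p) sequent \<Rightarrow> ('f, 'p) fm signed multiset" where
  "sign S = image_mset Left (antecedent S) + image_mset Right (succedent S)"

text \<open>
  Together, \<open>ante\<close> and \<open>succ\<close> invert \<open>sign\<close>.
\<close>

definition ante :: "'a signed multiset \<Rightarrow> 'a multiset" where
  "ante S = image_mset unsigned (filter_mset is_Left S)"

definition succ :: "'a signed multiset \<Rightarrow> 'a multiset" where
  "succ S = image_mset unsigned (filter_mset (\<lambda>\<phi>. \<not> is_Left \<phi>) S)"

lemma ante_simps [simp]:
  "ante {#} = {#}" "ante (add_mset (Left A) S) = add_mset A (ante S)"
  "ante (add_mset (Right A) S) = ante S" "ante (S + S') = ante S + ante S'"
  by (simp_all add: ante_def)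

lemma succ_simps [simp]:
  "succ {#} = {#}" "succ (add_mset (Left A) S) = succ S"
  "succ (add_mset (Right A) S) = add_mset A (succ S)" "succ (S + S') = succ S + succ S'"
  by (simp_all add: succ_def)

lemma ante_sign [simp]: "ante (sign S) = antecedent S"
proof -
  have "ante (image_mset Left M) = M" and "ante (image_mset Right M) = {#}" for M :: "('a, 'b) fm multiset"
    by (induction M) auto
  then show ?thesis by (simp add: sign_def)
qed

lemma succ_sign [simp]: "succ (sign S) = succedent S"
proof -
  have "succ (image_mset Right M) = M" and "succ (image_mset Left M) = {#}" for M :: "('a, 'b) fm multiset"
    by (induction M) auto
  then show ?thesis by (simp add: sign_def)
qed

lemma ante_ctx [simp]: "ante (ctx cl \<phi> S) = ante S"
  by (simp add: ante_def ctx_def filter_filter_mset)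

lemma succ_ctx: "succ (ctx cl \<phi> S) = (if one_sided cl \<phi> then {#} else succ S)"
  by (auto simp: succ_def ctx_def filter_filter_mset)

lemma ctx_sign:
  fixes \<Gamma> \<Delta> :: "('f, 'p) fm multiset"
  shows "ctx cl \<phi> (sign (\<Gamma> \<turnstile> \<Delta>)) = sign (\<Gamma> \<turnstile> (if one_sided cl \<phi> then {#} else \<Delta>))"
proof -
  have l: "filter_mset is_Left (image_mset Left M) = image_mset Left M"
    and r: "filter_mset is_Left (image_mset Right M) = {#}" for M :: "('f, 'p) fm multiset"
    by (induction M) auto
  have "filter_mset is_Left (sign (\<Gamma> \<turnstile> \<Delta>)) = sign (\<Gamma> \<turnstile> {#})"
    by (simp only: sign_def filter_union_mset sequent.sel l r image_mset_empty)
  then show ?thesis by (simp add: ctx_def)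
qed

lemma set_ante: "set_mset (ante S) = lefts S"
  by (force simp: ante_def lefts_def image_iff split: signed.splits)

lemma mem_succ: "A \<in># succ S \<longleftrightarrow> Right A \<in># S"
proof
  assume "A \<in># succ S"
  then obtain \<phi> where "\<phi> \<in># S" "\<not> is_Left \<phi>" "A = unsigned \<phi>" by (auto simp: succ_def)
  then show "Right A \<in># S" by (cases \<phi>) auto
qed (force simp: succ_def)

lemma is_sequent_iff:
  "is_sequent L (ante S \<turnstile> succ S) \<longleftrightarrow> (\<forall>\<phi>\<in>#S. is_formula L (unsigned \<phi>))"
  by (auto simp: is_sequent_def ante_def succ_def)

definition G3 :: "('f, 'p) language \<Rightarrow> bool \<Rightarrow> bool \<Rightarrow> ('f, 'p) rule set" where
  "G3 L cl efq = {Init, L_and, R_and, L_or, R_or, if cl then L_imp else Li_imp,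
    if cl then R_imp else Ri_imp, if efq then L_bot else Init_bot, L_all L,
    if cl then R_all else Ri_all, L_ex, R_ex L}"

lemma G3m_eq: "G3m L = G3 L False False"
  and G3i_eq: "G3i L = G3 L False True"
  and G3c_eq: "G3c L = G3 L True True"
  by (simp_all add: G3m_def G3i_def G3c_def G3_def)

lemma derivable_is_sequent: "derivable L C S \<Longrightarrow> is_sequent L S"
  by (erule derivable.cases) simp

subsection \<open>Entailed atoms are derivable by replacement\<close>

lemma is_atomic_subst [simp]: "is_atomic (subst P x t) = is_atomic P"
  by (cases P) auto

lemma derivable_replace:
  assumes C: "R12_r \<subseteq> C" and P: "is_atomic P" and eq: "Eq r s \<in># \<Gamma> \<or> Eq s r \<in># \<Gamma>"
    and d: "derivable L C (\<Gamma> \<turnstile> add_mset (subst P x r) \<Delta>)"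
  shows "derivable L C (\<Gamma> \<turnstile> add_mset (subst P x s) \<Delta>)"
proof -
  have wf: "is_sequent L (\<Gamma> \<turnstile> add_mset (subst P x r) \<Delta>)" using d by (rule derivable_is_sequent)
  then have "\<forall>A\<in>#\<Gamma>. is_formula L A" by (simp add: is_sequent_def)
  then have "is_term L s" using eq is_formula_simps(1) by blast
  then have seq: "is_sequent L (\<Gamma> \<turnstile> add_mset (subst P x s) \<Delta>)"
    using wf is_formula_replace[OF P] by (auto simp: is_sequent_def)
  from eq show ?thesis
  proof
    assume "Eq r s \<in># \<Gamma>"
    then obtain \<Gamma>' where \<Gamma>': "\<Gamma> = {#Eq r s#} + \<Gamma>'" by (metis add_mset_add_single mset_add union_commute)
    show ?thesis
    proof (rule derivable.step)
      show "Rep1_r \<in> C" using C by (simp add: R12_r_def)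
      show "([\<Gamma> \<turnstile> \<Delta> + {#subst P x r#}], \<Gamma> \<turnstile> add_mset (subst P x s) \<Delta>) \<in> Rep1_r"
        unfolding Rep1_r_def \<Gamma>' add_mset_add_single[of _ \<Delta>] using P by blast
    qed (use d seq in simp_all)
  next
    assume "Eq s r \<in># \<Gamma>"
    then obtain \<Gamma>' where \<Gamma>': "\<Gamma> = {#Eq s r#} + \<Gamma>'" by (metis add_mset_add_single mset_add union_commute)
    show ?thesis
    proof (rule derivable.step)
      show "Rep2_r \<in> C" using C by (simp add: R12_r_def)
      show "([\<Gamma> \<turnstile> \<Delta> + {#subst P x r#}], \<Gamma> \<turnstile> add_mset (subst P x s) \<Delta>) \<in> Rep2_r"
        unfolding Rep2_r_def \<Gamma>' add_mset_add_single[of _ \<Delta>] using P by blast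
    qed (use d seq in simp_all)
  qed
qed

text \<open>
  An equivalence, since the case of symmetry would otherwise fail. In the case of an argument, the
  position that changes is marked by \<open>x\<close> inside the raw atom \<open>Q\<close>.
\<close>

lemma derivable_eqv:
  assumes C: "R12_r \<subseteq> C" and \<Gamma>: "\<forall>A\<in>#\<Gamma>. is_formula L A"
  shows "eqv (set_mset \<Gamma>) t u \<Longrightarrow> is_term L t \<Longrightarrow> is_atomic P \<Longrightarrow>
    derivable L C (\<Gamma> \<turnstile> add_mset (subst P x t) \<Delta>) \<longleftrightarrow> derivable L C (\<Gamma> \<turnstile> add_mset (subst P x u) \<Delta>)"
proof (induction arbitrary: P rule: eqv.induct)
  case (base t u)
  then show ?case using derivable_replace[OF C] by blast
next
  case (sym t u)
  then show ?case using eqv_is_term[OF sym.hyps \<Gamma>] by blast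
next
  case (trans t u v)
  then show ?case using eqv_is_term[OF trans.hyps(1) \<Gamma>] by blast
next
  case (arg t u f ts us)
  have closed: "is_term L v" if "v \<in> insert t (set ts \<union> set us)" for v
    using arg.prems(1) that by (auto simp: is_term_def)
  have "map (\<lambda>v. subst_tm v x w) ts = ts" "map (\<lambda>v. subst_tm v x w) us = us" for w
    by (auto intro!: map_idI subst_tm_closed[where L = L] closed)
  moreover define Q where "Q = subst P x (Fn f (ts @ BVar x # us))"
  ultimately have "subst P x (Fn f (ts @ w # us)) = subst Q x w" for w
    using subst_subst[OF arg.prems(2)] by simp
  moreover have "is_atomic Q" using arg.prems(2) by (simp add: Q_def)
  ultimately show ?case using arg.IH[of Q] closed by simp
qed simp

text \<open>
  The arguments are rewritten from left to right; \<open>vs\<close> holds those that are done.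
\<close>

lemma derivable_eqv_args:
  assumes C: "R12_r \<subseteq> C" and \<Gamma>: "\<forall>A\<in>#\<Gamma>. is_formula L A"
  shows "list_all2 (eqv (set_mset \<Gamma>)) ts us \<Longrightarrow> derivable L C (\<Gamma> \<turnstile> add_mset (Pred p (vs @ ts)) \<Delta>) \<Longrightarrow>
    derivable L C (\<Gamma> \<turnstile> add_mset (Pred p (vs @ us)) \<Delta>)"
proof (induction arbitrary: vs rule: list_all2_induct)
  case (Cons t ts u us)
  have closed: "is_term L v" if "v \<in> insert t (set vs \<union> set ts)" for v
    using derivable_is_sequent[OF Cons.prems] that by (auto simp: is_sequent_def is_formula_def is_term_def)
  have *: "map (\<lambda>v. subst_tm v 0 w) vs = vs" "map (\<lambda>v. subst_tm v 0 w) ts = ts" for w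
    by (auto intro!: map_idI subst_tm_closed[where L = L] closed)
  have "derivable L C (\<Gamma> \<turnstile> add_mset (Pred p (vs @ u # ts)) \<Delta>)"
    using derivable_eqv[OF C \<Gamma> Cons.hyps(1) closed, of "Pred p (vs @ BVar 0 # ts)" 0 \<Delta>] * Cons.prems
    by simp
  then show ?case using Cons.IH[of "vs @ [u]"] by simp
qed simp

lemma derivable_entailed:
  assumes C: "R12_r \<subseteq> C" "Init \<in> C" and ent: "entails (set_mset \<Gamma>) A" and A: "is_atomic A"
    and seq: "is_sequent L (\<Gamma> \<turnstile> add_mset A \<Delta>)"
  shows "derivable L C (\<Gamma> \<turnstile> add_mset A \<Delta>)"
proof -
  have \<Gamma>: "\<forall>A\<in>#\<Gamma>. is_formula L A" using seq by (simp add: is_sequent_def)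
  from ent show ?thesis
  proof cases
    case (Eq t u)
    have t: "is_term L t" and "is_term L u" using seq Eq by (auto simp: is_sequent_def)
    have "derivable L C (\<Gamma> \<turnstile> add_mset (Eq t t) \<Delta>)"
    proof (rule derivable.step)
      show "Ref \<in> C" using C(1) by (simp add: R12_r_def)
      show "([], \<Gamma> \<turnstile> add_mset (Eq t t) \<Delta>) \<in> Ref" by (auto simp: Ref_def)
    qed (use seq t in \<open>auto simp: is_sequent_def\<close>)
    then show ?thesis
      \<comment> \<open>Rewriting the right-hand side of \<open>t = t\<close>.\<close>
      using derivable_eqv[OF C(1) \<Gamma> Eq(2) t, of "Eq t (BVar 0)" 0 \<Delta>] Eq(1) by (simp add: subst_tm_closed[OF t])
  next
    case (Pred p ts us)
    obtain \<Gamma>' where \<Gamma>': "\<Gamma> = {#Pred p ts#} + \<Gamma>'"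
      using Pred(2) by (metis add_mset_add_single mset_add union_commute)
    have P: "is_atomic (Pred p ts)" by simp
    have "derivable L C (\<Gamma> \<turnstile> add_mset (Pred p ts) \<Delta>)"
    proof (rule derivable.step[OF C(2)])
      show "([], \<Gamma> \<turnstile> add_mset (Pred p ts) \<Delta>) \<in> Init"
        unfolding Init_def \<Gamma>' add_mset_add_single[of _ \<Delta>] using P by blast
    qed (use seq \<Gamma> Pred(2) in \<open>auto simp: is_sequent_def\<close>)
    then show ?thesis using derivable_eqv_args[OF C(1) \<Gamma> Pred(3), of p "[]"] Pred(1) by simp
  qed (use A in simp)
qed

subsection \<open>The two translations\<close>

context sequent_calculus
begin

lemma inst_is_formula:
  "inst \<phi> ps \<Longrightarrow> X \<in> ps \<Longrightarrow> \<psi> \<in># X \<Longrightarrow> is_formula L (unsigned \<phi>) \<Longrightarrow> is_formula L (unsigned \<psi>)"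
  by (erule inst.cases)
    (auto intro: is_formula_subst_Forall is_formula_subst_Exists split: if_splits)

text \<open>
  Being a sequent of the language is required of the conclusion only: it is inherited by the
  premisses, as the rules of \<open>der\<close> decompose formulas and instantiate quantifiers with terms.
\<close>

lemma der_imp_derivable:
  "der S \<Longrightarrow> is_sequent L (ante S \<turnstile> succ S) \<Longrightarrow> derivable L (G3 L cl efq \<union> R12_r) (ante S \<turnstile> succ S)"
proof (induction rule: der.induct)
  case (axiomatic S)
  show ?case
  proof (cases "\<exists>A. is_atomic A \<and> A \<in># succ S \<and> entails (set_mset (ante S)) A")
    case True
    then obtain A \<Delta> where A: "is_atomic A" "succ S = add_mset A \<Delta>" "entails (set_mset (ante S)) A"
      by (metis mset_add)
    then show ?thesis using axiomatic.prems by (auto intro!: derivable_entailed simp: G3_def)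
  next
    case False
    have bot: "Bot \<in># ante S \<and> (efq \<or> Bot \<in># succ S)"
    proof -
      have "efq \<and> Bot \<in> lefts S \<or> (\<exists>A. A \<in># succ S \<and> entails (lefts S) A)"
        using axiomatic.hyps unfolding axiomatic_def mem_succ by (auto simp: lefts_def)
      with False show ?thesis
        unfolding set_ante using entails_atomic by blast
    qed
    then obtain \<Gamma> where \<Gamma>: "ante S = {#Bot#} + \<Gamma>" by (metis add_mset_add_single mset_add union_commute)
    show ?thesis
    proof (cases efq)
      case True
      show ?thesis
      proof (rule derivable.step)
        show "L_bot \<in> G3 L cl efq \<union> R12_r" using True by (simp add: G3_def)
        show "([], ante S \<turnstile> succ S) \<in> L_bot" unfolding \<Gamma> L_bot_def by blast
      qed (use axiomatic.prems in simp_all)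
    next
      case False
      then obtain \<Delta> where \<Delta>: "succ S = \<Delta> + {#Bot#}" using bot by (metis add_mset_add_single mset_add)
      show ?thesis
      proof (rule derivable.step)
        show "Init_bot \<in> G3 L cl efq \<union> R12_r" using False by (simp add: G3_def)
        show "([], ante S \<turnstile> succ S) \<in> Init_bot" unfolding \<Gamma> \<Delta> Init_bot_def by blast
      qed (use axiomatic.prems in simp_all)
    qed
  qed
next
  case (rule \<phi> ps S)
  let ?G = "ante S" and ?D = "succ S" and ?C = "G3 L cl efq \<union> R12_r"
  have IH: "derivable L ?C (ante X + ?G \<turnstile> succ X + (if one_sided cl \<phi> then {#} else ?D))"
    if X: "X \<in> ps" for X
  proof -
    have "is_sequent L (ante (X + ctx cl \<phi> S) \<turnstile> succ (X + ctx cl \<phi> S))"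
      unfolding is_sequent_iff
      using rule.prems[unfolded is_sequent_iff] inst_is_formula[OF rule.hyps(1) X]
      by (auto simp: ctx_def split: if_splits)
    from rule.IH[OF X this] show ?thesis by (simp add: succ_ctx)
  qed
  have concl: "derivable L ?C S'"
    if "\<rho> \<in> ?C" "(Ss, S') \<in> \<rho>" "\<forall>S\<in>set Ss. derivable L ?C S"
      "S' = (ante (add_mset \<phi> S) \<turnstile> succ (add_mset \<phi> S))" for \<rho> Ss S'
    using that rule.prems by (auto intro: derivable.step)
  \<comment> \<open>The eigenvariable for the quantifier rules.\<close>
  obtain a where a: "a \<notin> fv (unsigned \<phi>) \<union> fv_sequent (?G \<turnstile> ?D)"
    using ex_new_if_finite[OF infinite_UNIV_nat, of "fv (unsigned \<phi>) \<union> fv_sequent (?G \<turnstile> ?D)"]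
    by (auto simp: fv_sequent_def)
  show ?case
    using rule.hyps(1)
  proof cases
    case (Left_Conj A B)
    have "derivable L ?C ({#Conj A B#} + ?G \<turnstile> ?D)"
    proof (rule concl)
      show "L_and \<in> ?C" by (simp add: G3_def)
      show "([{#A, B#} + ?G \<turnstile> ?D], {#Conj A B#} + ?G \<turnstile> ?D) \<in> L_and" unfolding L_and_def by blast
    qed (use IH[of "{#Left A, Left B#}"] Left_Conj in simp_all)
    then show ?thesis by (simp add: Left_Conj)
  next
    case (Right_Conj A B)
    have "derivable L ?C (?G \<turnstile> ?D + {#Conj A B#})"
    proof (rule concl)
      show "R_and \<in> ?C" by (simp add: G3_def)
      show "([?G \<turnstile> ?D + {#A#}, ?G \<turnstile> ?D + {#B#}], ?G \<turnstile> ?D + {#Conj A B#}) \<in> R_and"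
        unfolding R_and_def by blast
    qed (use IH[of "{#Right A#}"] IH[of "{#Right B#}"] Right_Conj in simp_all)
    then show ?thesis by (simp add: Right_Conj)
  next
    case (Left_Disj A B)
    have "derivable L ?C ({#Disj A B#} + ?G \<turnstile> ?D)"
    proof (rule concl)
      show "L_or \<in> ?C" by (simp add: G3_def)
      show "([{#A#} + ?G \<turnstile> ?D, {#B#} + ?G \<turnstile> ?D], {#Disj A B#} + ?G \<turnstile> ?D) \<in> L_or"
        unfolding L_or_def by blast
    qed (use IH[of "{#Left A#}"] IH[of "{#Left B#}"] Left_Disj in simp_all)
    then show ?thesis by (simp add: Left_Disj)
  next
    case (Right_Disj A B)
    have "derivable L ?C (?G \<turnstile> ?D + {#Disj A B#})"
    proof (rule concl)
      show "R_or \<in> ?C" by (simp add: G3_def)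
      show "([?G \<turnstile> ?D + {#A, B#}], ?G \<turnstile> ?D + {#Disj A B#}) \<in> R_or" unfolding R_or_def by blast
    qed (use IH[of "{#Right A, Right B#}"] Right_Disj in simp_all)
    then show ?thesis by (simp add: Right_Disj)
  next
    case (Left_Imp A B)
    have "derivable L ?C ({#Imp A B#} + ?G \<turnstile> ?D)"
    proof (cases cl)
      case True
      show ?thesis
      proof (rule concl)
        show "L_imp \<in> ?C" using True by (simp add: G3_def)
        show "([?G \<turnstile> ?D + {#A#}, {#B#} + ?G \<turnstile> ?D], {#Imp A B#} + ?G \<turnstile> ?D) \<in> L_imp"
          unfolding L_imp_def by blast
      qed (use IH[of "{#Right A#}"] IH[of "{#Left B#}"] Left_Imp True in simp_all)
    next
      case False
      show ?thesis
      proof (rule concl)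
        show "Li_imp \<in> ?C" using False by (simp add: G3_def)
        show "([{#Imp A B#} + ?G \<turnstile> ?D + {#A#}, {#B#} + ?G \<turnstile> ?D], {#Imp A B#} + ?G \<turnstile> ?D) \<in> Li_imp"
          unfolding Li_imp_def by blast
      qed (use IH[of "{#Right A, Left (Imp A B)#}"] IH[of "{#Left B#}"] Left_Imp False in simp_all)
    qed
    then show ?thesis by (simp add: Left_Imp)
  next
    case (Right_Imp A B)
    have "derivable L ?C (?G \<turnstile> ?D + {#Imp A B#})"
    proof (cases cl)
      case True
      show ?thesis
      proof (rule concl)
        show "R_imp \<in> ?C" using True by (simp add: G3_def)
        show "([{#A#} + ?G \<turnstile> ?D + {#B#}], ?G \<turnstile> ?D + {#Imp A B#}) \<in> R_imp"
          unfolding R_imp_def by blast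
      qed (use IH[of "{#Left A, Right B#}"] Right_Imp True in simp_all)
    next
      case False
      show ?thesis
      proof (rule concl)
        show "Ri_imp \<in> ?C" using False by (simp add: G3_def)
        show "([{#A#} + ?G \<turnstile> {#B#}], ?G \<turnstile> ?D + {#Imp A B#}) \<in> Ri_imp"
          unfolding Ri_imp_def by blast
      qed (use IH[of "{#Left A, Right B#}"] Right_Imp False in simp_all)
    qed
    then show ?thesis by (simp add: Right_Imp)
  next
    case (Left_Forall t x A)
    have "derivable L ?C ({#Forall x A#} + ?G \<turnstile> ?D)"
    proof (rule concl)
      show "L_all L \<in> ?C" by (simp add: G3_def)
      show "([{#subst A x t, Forall x A#} + ?G \<turnstile> ?D], {#Forall x A#} + ?G \<turnstile> ?D) \<in> L_all L"
        unfolding L_all_def using Left_Forall(3) by blast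
    qed (use IH[of "{#Left (subst A x t), Left (Forall x A)#}"] Left_Forall in simp_all)
    then show ?thesis by (simp add: Left_Forall)
  next
    case (Right_Forall x A)
    have fresh: "a \<notin> fv_sequent (?G \<turnstile> ?D + {#Forall x A#})"
      using a Right_Forall by (auto simp: fv_sequent_def)
    have X: "{#Right (subst A x (FVar a))#} \<in> ps" using Right_Forall by auto
    have "derivable L ?C (?G \<turnstile> ?D + {#Forall x A#})"
    proof (cases cl)
      case True
      show ?thesis
      proof (rule concl)
        show "R_all \<in> ?C" using True by (simp add: G3_def)
        show "([?G \<turnstile> ?D + {#subst A x (FVar a)#}], ?G \<turnstile> ?D + {#Forall x A#}) \<in> R_all"
          unfolding R_all_def using fresh by blast
      qed (use IH[OF X] Right_Forall True in simp_all)
    next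
      case False
      show ?thesis
      proof (rule concl)
        show "Ri_all \<in> ?C" using False by (simp add: G3_def)
        show "([?G \<turnstile> {#subst A x (FVar a)#}], ?G \<turnstile> ?D + {#Forall x A#}) \<in> Ri_all"
          unfolding Ri_all_def using fresh by blast
      qed (use IH[OF X] Right_Forall False in simp_all)
    qed
    then show ?thesis by (simp add: Right_Forall)
  next
    case (Left_Exists x A)
    have fresh: "a \<notin> fv_sequent ({#Exists x A#} + ?G \<turnstile> ?D)"
      using a Left_Exists by (auto simp: fv_sequent_def)
    have X: "{#Left (subst A x (FVar a))#} \<in> ps" using Left_Exists by auto
    have "derivable L ?C ({#Exists x A#} + ?G \<turnstile> ?D)"
    proof (rule concl)
      show "L_ex \<in> ?C" by (simp add: G3_def)
      show "([{#subst A x (FVar a)#} + ?G \<turnstile> ?D], {#Exists x A#} + ?G \<turnstile> ?D) \<in> L_ex"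
        unfolding L_ex_def using fresh by blast
    qed (use IH[OF X] Left_Exists in simp_all)
    then show ?thesis by (simp add: Left_Exists)
  next
    case (Right_Exists t x A)
    have "derivable L ?C (?G \<turnstile> ?D + {#Exists x A#})"
    proof (rule concl)
      show "R_ex L \<in> ?C" by (simp add: G3_def)
      show "([?G \<turnstile> ?D + {#Exists x A, subst A x t#}], ?G \<turnstile> ?D + {#Exists x A#}) \<in> R_ex L"
        unfolding R_ex_def using Right_Exists(3) by blast
    qed (use IH[of "{#Right (Exists x A), Right (subst A x t)#}"] Right_Exists in simp_all)
    then show ?thesis by (simp add: Right_Exists)
  qed
qed

text \<open>
  A cut on \<open>subst P x r\<close>, whose right premiss is an initial sequent: the equation and this atom
  entail \<open>subst P x s\<close>.
\<close>

lemma der_sign_replace: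
  assumes P: "is_atomic P" and d: "der (sign (\<Gamma> \<turnstile> \<Delta> + {#subst P x r#}))"
    and eq: "eqv (set_mset \<Gamma>) r s"
  shows "der (sign (\<Gamma> \<turnstile> \<Delta> + {#subst P x s#}))" (is "der ?S")
proof (rule cuttableD[OF cut])
  show "der (add_mset (Right (subst P x r)) ?S)"
    by (rule der_mono[OF d]) (auto simp: sign_def)
  have l: "lefts (add_mset (Left (subst P x r)) ?S) = insert (subst P x r) (set_mset \<Gamma>)"
    by (auto simp: lefts_def sign_def)
  have "entails (lefts (add_mset (Left (subst P x r)) ?S)) (subst P x s)"
    unfolding l by (rule entails_replace[OF P eqv_mono[OF eq]]) auto
  then show "der (add_mset (Left (subst P x r)) ?S)"
    by (auto intro!: der.axiomatic simp: axiomatic_def sign_def)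
qed

lemma sign_simps:
  "sign (\<Gamma> + {#A#} \<turnstile> \<Delta>) = add_mset (Left A) (sign (\<Gamma> \<turnstile> \<Delta>))"
  "sign ({#A#} + \<Gamma> \<turnstile> \<Delta>) = add_mset (Left A) (sign (\<Gamma> \<turnstile> \<Delta>))"
  "sign (add_mset A \<Gamma> \<turnstile> \<Delta>) = add_mset (Left A) (sign (\<Gamma> \<turnstile> \<Delta>))"
  "sign (\<Gamma> \<turnstile> \<Delta> + {#A#}) = add_mset (Right A) (sign (\<Gamma> \<turnstile> \<Delta>))"
  "sign (\<Gamma> \<turnstile> add_mset A \<Delta>) = add_mset (Right A) (sign (\<Gamma> \<turnstile> \<Delta>))"
  by (simp_all add: sign_def)

lemma fv_signed_sign: "\<psi> \<in># sign S \<Longrightarrow> fv_signed \<psi> \<subseteq> fv_sequent S"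
  by (auto simp: sign_def fv_sequent_def)

lemma derivable_imp_der: "derivable L (G3 L cl efq \<union> R12_r) S \<Longrightarrow> der (sign S)"
proof (induction rule: derivable.induct)
  case (step \<rho> Ss S)
  have prem: "\<forall>S'\<in>set Ss. der (sign S')" using step.IH by blast
  consider "\<rho> = Init" | "\<rho> = L_and" | "\<rho> = R_and" | "\<rho> = L_or" | "\<rho> = R_or"
    | "cl" "\<rho> = L_imp" | "\<not> cl" "\<rho> = Li_imp" | "cl" "\<rho> = R_imp" | "\<not> cl" "\<rho> = Ri_imp"
    | "efq" "\<rho> = L_bot" | "\<not> efq" "\<rho> = Init_bot" | "\<rho> = L_all L"
    | "cl" "\<rho> = R_all" | "\<not> cl" "\<rho> = Ri_all" | "\<rho> = L_ex" | "\<rho> = R_ex L"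
    | "\<rho> = Ref" | "\<rho> = Rep1_r" | "\<rho> = Rep2_r"
    using step.hyps(1)
    unfolding G3_def R12_r_def
    by (elim UnE insertE emptyE; cases cl; cases efq; simp)
  then show ?case
  proof cases
    case 1
    then obtain P where "is_atomic P" "P \<in> lefts (sign S)" "Right P \<in># sign S"
      using step.hyps(2) by (auto simp: Init_def lefts_def sign_def)
    then have "axiomatic (sign S)"
      unfolding axiomatic_def using entails_member by blast
    then show ?thesis by (rule der.axiomatic)
  next
    case 2
    then obtain A B \<Gamma> \<Delta> where S: "Ss = [{#A, B#} + \<Gamma> \<turnstile> \<Delta>]" "S = ({#Conj A B#} + \<Gamma> \<turnstile> \<Delta>)"
      using step.hyps(2) unfolding L_and_def by blast
    show ?thesis unfolding S sign_simps
      by (rule der.rule[OF inst.Left_Conj]) (use prem[unfolded S] in \<open>auto simp: sign_simps ctx_sign\<close>)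
  next
    case 3
    then obtain A B \<Gamma> \<Delta> where S: "Ss = [\<Gamma> \<turnstile> \<Delta> + {#A#}, \<Gamma> \<turnstile> \<Delta> + {#B#}]" "S = (\<Gamma> \<turnstile> \<Delta> + {#Conj A B#})"
      using step.hyps(2) unfolding R_and_def by blast
    show ?thesis unfolding S sign_simps
      by (rule der.rule[OF inst.Right_Conj]) (use prem[unfolded S] in \<open>auto simp: sign_simps ctx_sign\<close>)
  next
    case 4
    then obtain A B \<Gamma> \<Delta> where S: "Ss = [{#A#} + \<Gamma> \<turnstile> \<Delta>, {#B#} + \<Gamma> \<turnstile> \<Delta>]" "S = ({#Disj A B#} + \<Gamma> \<turnstile> \<Delta>)"
      using step.hyps(2) unfolding L_or_def by blast
    show ?thesis unfolding S sign_simps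
      by (rule der.rule[OF inst.Left_Disj]) (use prem[unfolded S] in \<open>auto simp: sign_simps ctx_sign\<close>)
  next
    case 5
    then obtain A B \<Gamma> \<Delta> where S: "Ss = [\<Gamma> \<turnstile> \<Delta> + {#A, B#}]" "S = (\<Gamma> \<turnstile> \<Delta> + {#Disj A B#})"
      using step.hyps(2) unfolding R_or_def by blast
    show ?thesis unfolding S sign_simps
      by (rule der.rule[OF inst.Right_Disj]) (use prem[unfolded S] in \<open>auto simp: sign_simps ctx_sign\<close>)
  next
    case 6
    then obtain A B \<Gamma> \<Delta> where S: "Ss = [\<Gamma> \<turnstile> \<Delta> + {#A#}, {#B#} + \<Gamma> \<turnstile> \<Delta>]" "S = ({#Imp A B#} + \<Gamma> \<turnstile> \<Delta>)"
      using step.hyps(2) unfolding L_imp_def by blast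
    have "der (X + ctx cl (Left (Imp A B)) (sign (\<Gamma> \<turnstile> \<Delta>)))" if "X \<in> {{#Right A#}, {#Left B#}}" for X
      using that prem[unfolded S] by (auto simp: sign_simps ctx_sign)
    then show ?thesis unfolding S sign_simps
      by (intro der.rule[OF inst.Left_Imp]) (simp add: 6(1))
  next
    case 7
    then obtain A B \<Gamma> \<Delta> where S: "Ss = [{#Imp A B#} + \<Gamma> \<turnstile> \<Delta> + {#A#}, {#B#} + \<Gamma> \<turnstile> \<Delta>]"
      "S = ({#Imp A B#} + \<Gamma> \<turnstile> \<Delta>)"
      using step.hyps(2) unfolding Li_imp_def by blast
    have "der (X + ctx cl (Left (Imp A B)) (sign (\<Gamma> \<turnstile> \<Delta>)))"
      if "X \<in> {{#Right A, Left (Imp A B)#}, {#Left B#}}" for X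
      using that prem[unfolded S] by (auto simp: sign_simps ctx_sign add_mset_commute)
    then show ?thesis unfolding S sign_simps
      by (intro der.rule[OF inst.Left_Imp]) (simp add: 7(1))
  next
    case 8
    then obtain A B \<Gamma> \<Delta> where S: "Ss = [{#A#} + \<Gamma> \<turnstile> \<Delta> + {#B#}]" "S = (\<Gamma> \<turnstile> \<Delta> + {#Imp A B#})"
      using step.hyps(2) unfolding R_imp_def by blast
    show ?thesis unfolding S sign_simps
      by (rule der.rule[OF inst.Right_Imp])
        (use prem[unfolded S] 8(1) in \<open>auto simp: sign_simps ctx_sign add_mset_commute\<close>)
  next
    case 9
    then obtain A B \<Gamma> \<Delta> where S: "Ss = [{#A#} + \<Gamma> \<turnstile> {#B#}]" "S = (\<Gamma> \<turnstile> \<Delta> + {#Imp A B#})"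
      using step.hyps(2) unfolding Ri_imp_def by blast
    show ?thesis unfolding S sign_simps
      by (rule der.rule[OF inst.Right_Imp])
        (use prem[unfolded S] 9(1) in \<open>auto simp: sign_simps ctx_sign add_mset_commute\<close>)
  next
    case 10
    then have "Left Bot \<in># sign S" using step.hyps(2) by (auto simp: L_bot_def sign_def)
    then have "axiomatic (sign S)" using 10(1) unfolding axiomatic_def by blast
    then show ?thesis by (rule der.axiomatic)
  next
    case 11
    then have "Left Bot \<in># sign S" "Right Bot \<in># sign S"
      using step.hyps(2) by (auto simp: Init_bot_def sign_def)
    then have "axiomatic (sign S)"
      unfolding axiomatic_def by (auto simp: lefts_def intro: entails.Bot)
    then show ?thesis by (rule der.axiomatic)
  next
    case 12
    then obtain A x t \<Gamma> \<Delta> where S: "Ss = [{#subst A x t, Forall x A#} + \<Gamma> \<turnstile> \<Delta>]"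
      "S = ({#Forall x A#} + \<Gamma> \<turnstile> \<Delta>)" and t: "is_term L t"
      using step.hyps(2) unfolding L_all_def by blast
    show ?thesis unfolding S sign_simps
      by (rule der.rule[OF inst.Left_Forall[OF t]]) (use prem[unfolded S] in \<open>auto simp: sign_simps ctx_sign\<close>)
  next
    case 13
    then obtain A x a \<Gamma> \<Delta> where S: "Ss = [\<Gamma> \<turnstile> \<Delta> + {#subst A x (FVar a)#}]"
      "S = (\<Gamma> \<turnstile> \<Delta> + {#Forall x A#})" and a: "a \<notin> fv_sequent (\<Gamma> \<turnstile> \<Delta> + {#Forall x A#})"
      using step.hyps(2) unfolding R_all_def by blast
    have "der (add_mset (Right (subst A x t)) (sign (\<Gamma> \<turnstile> \<Delta>)))" if "is_term L t" for t
      using der_eigenvariable[of x a "Right A" "sign (\<Gamma> \<turnstile> \<Delta>)" t] that prem[unfolded S] a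
        fv_signed_sign[of _ "\<Gamma> \<turnstile> \<Delta>"]
      by (fastforce simp: sign_simps fv_sequent_def)
    then show ?thesis unfolding S sign_simps
      by (intro der.rule[OF inst.Right_Forall]) (auto simp: ctx_sign 13(1))
  next
    case 14
    then obtain A x a \<Gamma> \<Delta> where S: "Ss = [\<Gamma> \<turnstile> {#subst A x (FVar a)#}]"
      "S = (\<Gamma> \<turnstile> \<Delta> + {#Forall x A#})" and a: "a \<notin> fv_sequent (\<Gamma> \<turnstile> \<Delta> + {#Forall x A#})"
      using step.hyps(2) unfolding Ri_all_def by blast
    have "der (add_mset (Right (subst A x t)) (sign (\<Gamma> \<turnstile> {#})))" if "is_term L t" for t
      using der_eigenvariable[of x a "Right A" "sign (\<Gamma> \<turnstile> {#})" t] that prem[unfolded S] a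
        fv_signed_sign[of _ "\<Gamma> \<turnstile> {#}"]
      by (fastforce simp: sign_simps fv_sequent_def)
    then show ?thesis unfolding S sign_simps
      by (intro der.rule[OF inst.Right_Forall]) (auto simp: ctx_sign 14(1))
  next
    case 15
    then obtain A x a \<Gamma> \<Delta> where S: "Ss = [{#subst A x (FVar a)#} + \<Gamma> \<turnstile> \<Delta>]"
      "S = ({#Exists x A#} + \<Gamma> \<turnstile> \<Delta>)" and a: "a \<notin> fv_sequent ({#Exists x A#} + \<Gamma> \<turnstile> \<Delta>)"
      using step.hyps(2) unfolding L_ex_def by blast
    have "der (add_mset (Left (subst A x t)) (sign (\<Gamma> \<turnstile> \<Delta>)))" if "is_term L t" for t
      using der_eigenvariable[of x a "Left A" "sign (\<Gamma> \<turnstile> \<Delta>)" t] that prem[unfolded S] a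
        fv_signed_sign[of _ "\<Gamma> \<turnstile> \<Delta>"]
      by (fastforce simp: sign_simps fv_sequent_def)
    then show ?thesis unfolding S sign_simps
      by (intro der.rule[OF inst.Left_Exists]) (auto simp: ctx_sign)
  next
    case 16
    then obtain A x t \<Gamma> \<Delta> where S: "Ss = [\<Gamma> \<turnstile> \<Delta> + {#Exists x A, subst A x t#}]"
      "S = (\<Gamma> \<turnstile> \<Delta> + {#Exists x A#})" and t: "is_term L t"
      using step.hyps(2) unfolding R_ex_def by blast
    show ?thesis unfolding S sign_simps
      by (rule der.rule[OF inst.Right_Exists[OF t]]) (use prem[unfolded S] in \<open>auto simp: sign_simps ctx_sign\<close>)
  next
    case 17
    then obtain t \<Gamma> \<Delta> where "S = (\<Gamma> \<turnstile> \<Delta> + {#Eq t t#})"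
      using step.hyps(2) unfolding Ref_def by blast
    then have "Right (Eq t t) \<in># sign S" by (simp add: sign_def)
    then have "axiomatic (sign S)"
      unfolding axiomatic_def by (auto intro: entails.Eq eqv.refl)
    then show ?thesis by (rule der.axiomatic)
  next
    case 18
    then obtain P x r s \<Gamma> \<Delta> where S: "Ss = [{#Eq r s#} + \<Gamma> \<turnstile> \<Delta> + {#subst P x r#}]"
      "S = ({#Eq r s#} + \<Gamma> \<turnstile> \<Delta> + {#subst P x s#})" and P: "is_atomic P"
      using step.hyps(2) unfolding Rep1_r_def by blast
    show ?thesis unfolding S
      by (rule der_sign_replace[OF P]) (use prem[unfolded S] in \<open>auto intro: eqv.base\<close>)
  next
    case 19
    then obtain P x r s \<Gamma> \<Delta> where S: "Ss = [{#Eq s r#} + \<Gamma> \<turnstile> \<Delta> + {#subst P x r#}]"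
      "S = ({#Eq s r#} + \<Gamma> \<turnstile> \<Delta> + {#subst P x s#})" and P: "is_atomic P"
      using step.hyps(2) unfolding Rep2_r_def by blast
    show ?thesis unfolding S
      by (rule der_sign_replace[OF P]) (use prem[unfolded S] in \<open>auto intro: eqv.base eqv.sym\<close>)
  qed
qed

lemma derivable_iff_der:
  "derivable L (G3 L cl efq \<union> R12_r) S \<longleftrightarrow> is_sequent L S \<and> der (sign S)"
  using derivable_imp_der derivable_is_sequent der_imp_derivable[of "sign S"] by auto

lemma structural_admissible:
  assumes "\<rho> \<in> structural_rules"
  shows "admissible L (G3 L cl efq \<union> R12_r) \<rho>"
proof -
  have "der (sign S)" if inst: "(Ss, S) \<in> \<rho>" and prem: "\<And>S'. S' \<in> set Ss \<Longrightarrow> der (sign S')" for Ss S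
  proof -
    consider "\<rho> = Cut" | "\<rho> = L_weakening \<or> \<rho> = R_weakening \<or> \<rho> = L_contraction \<or> \<rho> = R_contraction"
      using assms by (auto simp: structural_rules_def)
    then show ?thesis
    proof cases
      case 1
      then obtain A \<Gamma> \<Delta> \<Lambda> \<Theta> where S: "Ss = [\<Gamma> \<turnstile> \<Delta> + {#A#}, {#A#} + \<Lambda> \<turnstile> \<Theta>]"
        "S = (\<Gamma> + \<Lambda> \<turnstile> \<Delta> + \<Theta>)"
        using inst unfolding Cut_def by blast
      have l: "der (sign (\<Gamma> \<turnstile> \<Delta> + {#A#}))" and r: "der (sign ({#A#} + \<Lambda> \<turnstile> \<Theta>))"
        using prem S by simp_all
      show ?thesis
      proof (rule cuttableD[OF cut])
        show "der (add_mset (Right A) (sign S))" by (rule der_mono[OF l]) (auto simp: S sign_def)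
        show "der (add_mset (Left A) (sign S))" by (rule der_mono[OF r]) (auto simp: S sign_def)
      qed
    next
      case 2
      then have "\<exists>S'. Ss = [S'] \<and> set_mset (sign S') \<subseteq> set_mset (sign S)"
        using inst by (elim disjE)
          (auto simp: L_weakening_def R_weakening_def L_contraction_def R_contraction_def sign_def)
      then obtain S' where "Ss = [S']" and sub: "set_mset (sign S') \<subseteq> set_mset (sign S)" by blast
      then show ?thesis using prem der_mono[OF _ sub] by simp
    qed
  qed
  then show ?thesis unfolding admissible_def derivable_iff_der by blast
qed

end

theorem theorem5:
  fixes L :: "('f, 'p) language"
  shows "\<forall>G \<in> {G3m L, G3i L, G3c L}. \<forall>\<rho> \<in> structural_rules. admissible L (G \<union> R12_r) \<rho>"
  unfolding G3m_eq G3i_eq G3c_eq using sequent_calculus.structural_admissible by blast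

end
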